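(* Consider a system with matrices $A\in\mathbb{R}^{n\times n}$, $C\in\mathbb{R}^{q\times n}$, $F\in\mathbb{R}^{r\times n}$ in its Jordan canonical form, with corresponding matrices $A_{\mathrm J},C_{\mathrm J},F_{\mathrm J}$. Assume that the system does not exhibit multiple Jordan blocks associated with the same eigenvalue. Suppose $F_{\mathrm J}=\alpha C_{\mathrm J}Q$ for some $\alpha\in\mathbb{R}^{r\times q}$ and some nonsingular block diagonal matrix $Q=\operatorname{diag}\{Q_j\}_{j=1}^w\in\mathbb{C}^{n\times n}$ of the structure defined in the context. Then, using a sampling scheme $\{t_i\}_{i=1}^k$ such that $$\operatorname{rank}\big(O_{\mathrm s}(A_{\mathrm{ob,F}},F_{\mathrm{ob}})\big)=n-p_F$$ guarantees sample-based functional observability of $(A,C,F)$ (for that sampling scheme). (The statement holds both in the continuous-time and in the discrete-time setting, with the corresponding sample-based observability matrix $O_{\mathrm s}$.)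
   Context: System: $x^+=Ax(t)+Bu(t)$, $y(t)=Cx(t)+Du(t)$, $z(t)=Fx(t)$ with $A\in\mathbb{R}^{n\times n}$, $B\in\mathbb{R}^{n\times m}$, $C\in\mathbb{R}^{q\times n}$, $D\in\mathbb{R}^{q\times m}$, $F\in\mathbb{R}^{r\times n}$, where $x^+$ denotes $\dot x(t)$ for continuous-time systems and $x(t+1)$ for discrete-time systems. Jordan canonical form: the system in Jordan canonical form is denoted $(A_{\mathrm J},B_{\mathrm J},C_{\mathrm J},D_{\mathrm J},F_{\mathrm J})$, i.e. for an invertible complex matrix $P_{\mathrm J}$, $A_{\mathrm J}=P_{\mathrm J}^{-1}AP_{\mathrm J}$ is a (complex) Jordan matrix, $C_{\mathrm J}=CP_{\mathrm J}$, $F_{\mathrm J}=FP_{\mathrm J}$, $B_{\mathrm J}=P_{\mathrm J}^{-1}B$, $D_{\mathrm J}=D$. The complex (not the real) Jordan form is used, so complex eigenvalues appear on the diagonal of $A_{\mathrm J}$. Structure of $Q$: let $A_{\mathrm J}$ have $w$ Jordan blocks of dimensions $k_1,\dots,k_w$. $Q\in\mathbb{C}^{n\times n}$ is a nonsingular block diagonal matrix $Q=\operatorname{diag}\{Q_j\}_{j=1}^w$, where each $Q_j$ has the same dimension $k_j$ as the corresponding Jordan block of $A_{\mathrm J}$ and is given by $Q_j=q_{j,1}I+q_{j,2}U_j+q_{j,3}U_j^2+\cdots+q_{j,k_j}U_j^{k_j-1}$ for given constants $q_{j,i}$ (possibly complex), where $U_j$ is the upper shift matrix of dimension $k_j$ (ones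 on the superdiagonal and zeros elsewhere). Observability matrix: for $M\in\mathbb{R}^{n\times n}$ and $N$ with $n$ columns, $O(M,N)$ is the matrix obtained by stacking $N, NM, NM^2,\dots,NM^{n-1}$ vertically. Sampling scheme: time instances $\{t_i\}_{i=1}^k$, $k\ge 1$, with $0\le t_1$ and $t_i<t_{i+1}$ for $i=1,\dots,k-1$ (real numbers in continuous time, integers in discrete time). Sample-based observability matrix: for a pair $(M,N)$, $O_{\mathrm s}(M,N)$ is the matrix obtained by stacking vertically $Ne^{Mt_1},\dots,Ne^{Mt_k}$ in the continuous-time case, and $NM^{t_1},\dots,NM^{t_k}$ in the discrete-time case. Observable subsystem of $(A,F)$ and the constant $\sigma$: let $p_F$ be the dimension of the unobservable subspace $\operatorname{null}(O(A,F))$ of $(A,F)$. There is an invertible $P_{\mathrm{o,F}}\in\mathbb{R}^{n\times n}$ with $$P_{\mathrm{o,F}}^{-1}AP_{\mathrm{o,F}}=\begin{pmatrix}A_{\mathrm{ob,F}}&0\\ A_{21,\mathrm F}&A_{\overline{\mathrm{ob}},\mathrm F}\end{pmatrix},\qquad FP_{\mathrm{o,F}}=\begin{pmatrix}F_{\mathrm{ob}}&0\end{pmatrix},$$ where $(A_{\mathrm{ob,F}},F_{\mathrm{ob}})$ is observable of order $n-p_F$. Let $\nu$ be the observability index of $(A_{\mathrm{ob,F}},F_{\mathrm{ob}})$, i.e. the smallest integer such that the matrix obtained by stacking $F_{\mathrm{ob}},F_{\mathrm{ob}}A_{\mathrm{ob,F}},\dots,F_{\mathrm{ob}}A_{\mathrm{ob,F}}^{\nu-1}$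 has rank $n-p_F$. Set $\sigma=0$ if the system is continuous-time and $\sigma=\nu-2$ if it is discrete-time. Sample-based functional observability: $(A,C,F)$ is sample-based functionally observable for the sampling sequence $\{t_i\}_{i=1}^k$ if there exists a finite time $\bar t>\sigma$ such that for any initial state $x_0$ and input $u(t)$, the value of $Fx(t)$, $0\le t\le\bar t$, can be uniquely reconstructed from the knowledge of the input trajectory on the interval $[0,\bar t]$ and the sampled outputs $y(t_i)$, $i=1,\dots,k$. (In discrete time, times are integers.) *)

theory Defs
  imports
    "HOL-Analysis.Analysis"
    "Jordan_Normal_Form.Jordan_Normal_Form"
    "Jordan_Normal_Form.Matrix_Kernel"
    "Jordan_Normal_Form.DL_Rank"
begin

unbundle no vec_syntax
hide_type (open) Finite_Cartesian_Product.vec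
hide_const (open) Finite_Cartesian_Product.vec Finite_Cartesian_Product.mat
  Finite_Cartesian_Product.row Determinants.det

abbreviation mat_rank :: "'a::field mat \<Rightarrow> nat" where
  "mat_rank M \<equiv> vec_space.rank (dim_row M) M"

(* The column number nc is explicit because the list may be empty. *)
definition stack_mats :: "nat \<Rightarrow> 'a mat list \<Rightarrow> 'a mat" where
  "stack_mats nc Ms = mat_of_rows nc (concat (map rows Ms))"

definition append_cols :: "'a::zero mat \<Rightarrow> 'a mat \<Rightarrow> 'a mat" where
  "append_cols M N = four_block_mat M N (0\<^sub>m 0 (dim_col M)) (0\<^sub>m 0 (dim_col N))"

definition mat_exp :: "real mat \<Rightarrow> real mat" where
  "mat_exp M = mat (dim_row M) (dim_row M) (\<lambda>(i, j). \<Sum>k. (M ^\<^sub>m k) $$ (i, j) / fact k)"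


definition partial_obs_mat :: "nat \<Rightarrow> real mat \<Rightarrow> real mat \<Rightarrow> real mat" where
  "partial_obs_mat l M N = stack_mats (dim_col M) (map (\<lambda>i. N * M ^\<^sub>m i) [0..<l])"

definition obs_mat :: "real mat \<Rightarrow> real mat \<Rightarrow> real mat" where
  "obs_mat M N = partial_obs_mat (dim_row M) M N"

definition observable :: "real mat \<Rightarrow> real mat \<Rightarrow> bool" where
  "observable M N \<longleftrightarrow> mat_rank (obs_mat M N) = dim_row M"

definition unobs_dim :: "real mat \<Rightarrow> real mat \<Rightarrow> nat" where
  "unobs_dim M N = kernel_dim (obs_mat M N)"

(* Meant for observable pairs, for which the set under LEAST is nonempty. *)
definition obs_index :: "real mat \<Rightarrow> real mat \<Rightarrow> nat" where
  "obs_index M N = (LEAST l. mat_rank (partial_obs_mat l M N) = dim_row M)"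

(* P' is the inverse of P, so that P' * A * P is the block triangular matrix. *)
definition observable_decomposition ::
  "real mat \<Rightarrow> real mat \<Rightarrow> real mat \<Rightarrow> real mat \<Rightarrow> real mat \<Rightarrow> real mat \<Rightarrow> real mat \<Rightarrow> real mat \<Rightarrow> bool"
where
  "observable_decomposition A F P P' A_ob A21 A_unob F_ob \<longleftrightarrow>
     (let n = dim_row A; p = unobs_dim A F in
        A_ob \<in> carrier_mat (n - p) (n - p) \<and>
        A21 \<in> carrier_mat p (n - p) \<and>
        A_unob \<in> carrier_mat p p \<and>
        F_ob \<in> carrier_mat (dim_row F) (n - p) \<and>
        similar_mat_wit A (four_block_mat A_ob (0\<^sub>m (n - p) p) A21 A_unob) P P' \<and>
        F * P = append_cols F_ob (0\<^sub>m (dim_row F) p) \<and>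
        observable A_ob F_ob)"


(* The upper shift matrix of dimension k is jordan_block k 0; c i is the coefficient of its
   i-th power. *)
definition shift_poly :: "nat \<Rightarrow> (nat \<Rightarrow> complex) \<Rightarrow> complex mat" where
  "shift_poly k c = mat k k (\<lambda>(a, b). \<Sum>i<k. c i * (jordan_block k 0 ^\<^sub>m i) $$ (a, b))"

definition block_shift_poly :: "(nat \<times> complex) list \<Rightarrow> (nat \<Rightarrow> nat \<Rightarrow> complex) \<Rightarrow> complex mat" where
  "block_shift_poly js c =
     diag_block_mat (map (\<lambda>j. shift_poly (fst (js ! j)) (c j)) [0..<length js])"


definition sampling_scheme :: "'t::{linorder,zero} list \<Rightarrow> bool" where
  "sampling_scheme ts \<longleftrightarrow> ts \<noteq> [] \<and> 0 \<le> hd ts \<and> sorted_wrt (<) ts"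

definition sample_obs_mat_ct :: "real mat \<Rightarrow> real mat \<Rightarrow> real list \<Rightarrow> real mat" where
  "sample_obs_mat_ct M N ts = stack_mats (dim_col M) (map (\<lambda>t. N * mat_exp (t \<cdot>\<^sub>m M)) ts)"

definition sample_obs_mat_dt :: "real mat \<Rightarrow> real mat \<Rightarrow> nat list \<Rightarrow> real mat" where
  "sample_obs_mat_dt M N ts = stack_mats (dim_col M) (map (\<lambda>t. N * M ^\<^sub>m t) ts)"


(* The equation x' = A x + B u in integrated form, componentwise, so that discontinuous inputs
   are covered.  The Henstock-Kurzweil integral makes this hold for every classical solution and
   for every Caratheodory solution. *)
definition trajectory_ct ::
  "real mat \<Rightarrow> real mat \<Rightarrow> real vec \<Rightarrow> (real \<Rightarrow> real vec) \<Rightarrow> (real \<Rightarrow> real vec) \<Rightarrow> bool" where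
  "trajectory_ct A B x0 u x \<longleftrightarrow>
     x0 \<in> carrier_vec (dim_row A) \<and>
     (\<forall>t\<ge>0. u t \<in> carrier_vec (dim_col B) \<and> x t \<in> carrier_vec (dim_row A)) \<and>
     (\<forall>t\<ge>0. \<forall>i<dim_row A.
        ((\<lambda>s. (A *\<^sub>v x s + B *\<^sub>v u s) $ i) has_integral (x t $ i - x0 $ i)) {0..t})"

definition trajectory_dt ::
  "real mat \<Rightarrow> real mat \<Rightarrow> real vec \<Rightarrow> (nat \<Rightarrow> real vec) \<Rightarrow> (nat \<Rightarrow> real vec) \<Rightarrow> bool" where
  "trajectory_dt A B x0 u x \<longleftrightarrow>
     x0 \<in> carrier_vec (dim_row A) \<and>
     (\<forall>t. u t \<in> carrier_vec (dim_col B)) \<and>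
     x 0 = x0 \<and> (\<forall>t. x (Suc t) = A *\<^sub>v x t + B *\<^sub>v u t)"

(* R is the reconstruction map: it sees only the input on [0, tbar] and the sampled outputs. *)
definition sample_functionally_observable_ct ::
  "real mat \<Rightarrow> real mat \<Rightarrow> real mat \<Rightarrow> real mat \<Rightarrow> real mat \<Rightarrow> real list \<Rightarrow> bool" where
  "sample_functionally_observable_ct A B C D F ts \<longleftrightarrow>
     (\<exists>tbar > 0. \<exists>R :: (real \<Rightarrow> real vec) \<Rightarrow> real vec list \<Rightarrow> real \<Rightarrow> real vec.
        \<forall>x0 u x. trajectory_ct A B x0 u x \<longrightarrow>
          (\<forall>t\<in>{0..tbar}.
             F *\<^sub>v x t = R (restrict u {0..tbar}) (map (\<lambda>s. C *\<^sub>v x s + D *\<^sub>v u s) ts) t))"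

(* sigma is int (obs_index A_ob F_ob) - 2 for an observable subsystem (A_ob, F_ob) of (A, F);
   it may be negative, hence an integer. *)
definition sample_functionally_observable_dt ::
  "int \<Rightarrow> real mat \<Rightarrow> real mat \<Rightarrow> real mat \<Rightarrow> real mat \<Rightarrow> real mat \<Rightarrow> nat list \<Rightarrow> bool" where
  "sample_functionally_observable_dt \<sigma> A B C D F ts \<longleftrightarrow>
     (\<exists>tbar :: nat. int tbar > \<sigma> \<and> (\<exists>R :: (nat \<Rightarrow> real vec) \<Rightarrow> real vec list \<Rightarrow> nat \<Rightarrow> real vec.
        \<forall>x0 u x. trajectory_dt A B x0 u x \<longrightarrow>
          (\<forall>t\<in>{0..tbar}.
             F *\<^sub>v x t = R (restrict u {0..tbar}) (map (\<lambda>s. C *\<^sub>v x s + D *\<^sub>v u s) ts) t)))"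

end

theory Submission
  imports Defs "HOL-Computational_Algebra.Field_as_Ring" "Berlekamp_Zassenhaus.Chinese_Remainder_Poly"
begin

text \<open>Since distinct Jordan blocks have distinct eigenvalues, Hermite interpolation gives a polynomial
  \<open>p\<close> with \<open>Q = p(A\<^sub>J)\<close>.  Hence \<open>S = P\<^sub>J Q P\<^sub>J\<^sup>-\<^sup>1 = p(A)\<close> commutes with \<open>A\<close>, and \<open>F = \<alpha> C S\<close>.  Let \<open>e\<close> be
  the difference of two trajectories with the same input and the same samples, and \<open>w = S\<^sup>-\<^sup>1 e(0)\<close>.
  The output \<open>F\<close> of the autonomous system started at \<open>w\<close> is \<open>\<alpha> C e(t)\<close>, which vanishes at all
  sampling times, so by the rank condition \<open>w\<close> lies in the unobservable subspace of \<open>(A, F)\<close>.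
  This subspace is invariant under \<open>p(A)\<close>, hence contains \<open>e(0) = S w\<close>, and \<open>F e(t) = 0\<close> for all \<open>t\<close>.\<close>

hide_const (open) up_ring.coeff up_ring.monom module.smult

section \<open>Block shift polynomials are polynomials in the Jordan matrix\<close>

lemma shift_poly_dims [simp]:
  "dim_row (shift_poly k c) = k" "dim_col (shift_poly k c) = k"
  by (simp_all add: shift_poly_def)

text \<open>The i-th power of the upper shift has its ones exactly on the i-th superdiagonal, so
  only the summand with index \<open>b - a\<close> survives: the block is upper triangular Toeplitz.
  The case distinction guards against truncated subtraction.\<close>

lemma shift_poly_index:
  assumes "a < k" "b < k"
  shows "shift_poly k c $$ (a, b) = (if a \<le> b then c (b - a) else 0)"
proof -
  have "shift_poly k c $$ (a, b) = (\<Sum>i<k. c i * (if a \<le> b \<and> b - a = i then 1 else 0))"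
    unfolding shift_poly_def jordan_block_zero_pow using assms by simp
  also have "\<dots> = (\<Sum>i<k. if b - a = i then (if a \<le> b then c i else 0) else 0)"
    by (intro sum.cong) auto
  also have "\<dots> = (if a \<le> b then c (b - a) else 0)"
    using assms by (subst sum.delta') auto
  finally show ?thesis .
qed

text \<open>Expanding p(X + a) by the binomial theorem gives the Taylor coefficients of
  \<open>p\<close> at \<open>a\<close>. Summands with r < l vanish through the binomial coefficient,
  so the truncated exponent \<open>r - l\<close> does no harm there.\<close>

lemma coeff_pcompose_shift:
  fixes p :: "'a :: comm_ring_1 poly"
  shows "coeff (pcompose p [:a, 1:]) l = (\<Sum>r\<le>degree p. coeff p r * (of_nat (r choose l) * a ^ (r - l)))"
proof -
  have *: "coeff ([:a, 1:] ^ r) l = of_nat (r choose l) * a ^ (r - l)" for r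
  proof (cases "l \<le> r")
    case True
    then show ?thesis by (simp add: coeff_linear_poly_power)
  next
    case False
    have "degree ([:a, 1:] ^ r) \<le> r"
      using degree_power_le[of "[:a, 1:]" r] by simp
    then show ?thesis using False by (simp add: coeff_eq_0 binomial_eq_0)
  qed
  have "pcompose p [:a, 1:] = (\<Sum>r\<le>degree p. smult (coeff p r) ([:a, 1:] ^ r))"
    unfolding pcompose_altdef poly_altdef
    by (simp add: degree_map_poly coeff_map_poly)
  then show ?thesis by (simp add: coeff_sum *)
qed

text \<open>A Jordan block is a I + U with U nilpotent, so p(a I + U) is the Taylor expansion of
  \<open>p\<close> at \<open>a\<close> in powers of U. Linear combinations of matrices are written
  entrywise here and below, so that finite sums of matrices need not be formed.\<close>

lemma jordan_block_poly_index:
  fixes p :: "'a :: comm_ring_1 poly"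
  assumes "i < k" "j < k"
  shows "(\<Sum>r\<le>degree p. coeff p r * (jordan_block k a ^\<^sub>m r) $$ (i, j)) =
    (if i \<le> j then coeff (pcompose p [:a, 1:]) (j - i) else 0)"
proof (cases "i \<le> j")
  case True
  show ?thesis
    unfolding jordan_block_pow coeff_pcompose_shift if_P[OF True] using assms True by (intro sum.cong refl) simp
next
  case False
  then show ?thesis using assms by (simp add: jordan_block_pow)
qed

text \<open>This is Hermite interpolation as a Chinese remainder problem: fixing the first k Taylor
  coefficients at an eigenvalue means fixing \<open>p\<close> modulo the k-th power of the linear
  factor there. Distinct eigenvalues make these moduli pairwise coprime.\<close>

lemma exists_poly_taylor_coeffs:
  fixes js :: "(nat \<times> complex) list"
  assumes "distinct (map snd js)"
  shows "\<exists>p. \<forall>j<length js. \<forall>l<fst (js ! j). coeff (pcompose p [:snd (js ! j), 1:]) l = c j l"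
proof -
  \<comment> \<open>\<open>m j\<close> is the modulus belonging to block j, and \<open>u j\<close>
    is the truncated Taylor polynomial with the prescribed coefficients.\<close>
  define m where "m = (\<lambda>j. [:- snd (js ! j), 1:] ^ fst (js ! j))"
  define u where "u = (\<lambda>j. pcompose (\<Sum>l<fst (js ! j). monom (c j l) l) [:- snd (js ! j), 1:])"
  have "coprime (m i) (m j)" if "i < length js" "j < length js" "i \<noteq> j" for i j
  proof -
    have "snd (js ! i) \<noteq> snd (js ! j)"
      using assms that by (auto simp: distinct_conv_nth)
    have "coprime [:- snd (js ! i), 1:] [:- snd (js ! j), 1:]"
    proof (rule coprimeI)
      fix d :: "complex poly"
      assume "d dvd [:- snd (js ! i), 1:]" "d dvd [:- snd (js ! j), 1:]"
      \<comment> \<open>The difference of the two linear factors is a nonzero constant, so every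
        common divisor is a unit.\<close>
      then have "d dvd [:- snd (js ! i), 1:] - [:- snd (js ! j), 1:]" by (rule dvd_diff)
      then have "d dvd [:snd (js ! j) - snd (js ! i):]" by simp
      moreover have "is_unit [:snd (js ! j) - snd (js ! i):]"
        using \<open>snd (js ! i) \<noteq> snd (js ! j)\<close> by (simp add: is_unit_triv)
      ultimately show "is_unit d" by (rule dvd_unit_imp_unit)
    qed
    then show ?thesis 
      unfolding m_def by simp
  qed
  then obtain p where p: "[p = u j] (mod m j)" if "j < length js" for j
    using chinese_remainder_poly[of "{..<length js}" m u] by auto
  have "coeff (pcompose p [:snd (js ! j), 1:]) l = c j l" if j: "j < length js" and l: "l < fst (js ! j)" for j l
  proof -
    let ?a = "snd (js ! j)" and ?k = "fst (js ! j)"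
    obtain h where "p = u j + m j * h"
      using p[OF j] by (metis cong_iff_lin_poly cong_sym)
    \<comment> \<open>Substituting X + a turns \<open>m j\<close> into the monomial of degree k, so
      the multiple of the modulus leaves all coefficients below k untouched.\<close>
    then have "pcompose p [:?a, 1:] = (\<Sum>l<?k. monom (c j l) l) + monom 1 ?k * pcompose h [:?a, 1:]"
      by (simp add: u_def m_def pcompose_add pcompose_mult pcompose_hom.hom_power pcompose_pCons
          pcompose_assoc[symmetric] pcompose_idR monom_altdef)
    then show ?thesis using l by (simp add: coeff_sum coeff_monom_mult)
  qed
  then show ?thesis by blast
qed

text \<open>Outside the diagonal blocks both sides are zero, and inside a block the identity is
  assumed; the induction peels off the first block. The sizes \<open>d\<close> are shared by
  \<open>f\<close> and all \<open>g r\<close>, so that the blocks line up.\<close>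

lemma diag_block_mat_lincomb:
  fixes f :: "'b \<Rightarrow> 'a :: comm_ring_1 mat"
  assumes "\<And>x. x \<in> set xs \<Longrightarrow> f x \<in> carrier_mat (d x) (d x)"
    and "\<And>x r. x \<in> set xs \<Longrightarrow> g r x \<in> carrier_mat (d x) (d x)"
    and "\<And>x i j. x \<in> set xs \<Longrightarrow> i < d x \<Longrightarrow> j < d x \<Longrightarrow> f x $$ (i, j) = (\<Sum>r\<in>R. a r * g r x $$ (i, j))"
    and "i < sum_list (map d xs)" "j < sum_list (map d xs)"
  shows "diag_block_mat (map f xs) $$ (i, j) = (\<Sum>r\<in>R. a r * diag_block_mat (map (g r) xs) $$ (i, j))"
  using assms
proof (induction xs arbitrary: i j)
  case Nil
  then show ?case by simp
next
  case (Cons x xs)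
  have m: "map dim_row (map f xs) = map d xs" "map dim_col (map f xs) = map d xs"
    "map dim_row (map (g r) xs) = map d xs" "map dim_col (map (g r) xs) = map d xs" for r
    using carrier_matD[OF Cons.prems(1)] carrier_matD[OF Cons.prems(2)]
    by (simp_all add: comp_def)
  note dims = dim_diag_block_mat[of "map f xs", unfolded m] dim_diag_block_mat[of "map (g r) xs" for r, unfolded m]
  have hd: "f x \<in> carrier_mat (d x) (d x)" "g r x \<in> carrier_mat (d x) (d x)" for r
    using Cons.prems by auto
  have IH: "diag_block_mat (map f xs) $$ (i, j) = (\<Sum>r\<in>R. a r * diag_block_mat (map (g r) xs) $$ (i, j))"
    if "i < sum_list (map d xs)" "j < sum_list (map d xs)" for i j
    using Cons.prems that by (intro Cons.IH) auto
  show ?case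
  proof -
    have *: "diag_block_mat (map h (x # xs)) $$ (i, j) =
        (if i < d x then if j < d x then h x $$ (i, j) else 0
         else if j < d x then 0 else diag_block_mat (map h xs) $$ (i - d x, j - d x))"
      if "h x \<in> carrier_mat (d x) (d x)"
        "dim_row (diag_block_mat (map h xs)) = sum_list (map d xs)"
        "dim_col (diag_block_mat (map h xs)) = sum_list (map d xs)" for h :: "'b \<Rightarrow> 'a mat"
      using that Cons.prems(4,5) by (simp add: Let_def)
    show ?thesis
      unfolding *[of f, OF hd(1) dims(1,2)] *[of "g r" for r, OF hd(2) dims(3,4)]
      using Cons.prems(3)[of x i j] Cons.prems(4,5) IH[of "i - d x" "j - d x"] by simp
  qed
qed

lemma map_fst_nth: "map (\<lambda>j. fst (xs ! j)) [0..<length xs] = map fst xs"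
  by (rule nth_equalityI) simp_all

lemma block_shift_poly_carrier:
  "block_shift_poly js c \<in> carrier_mat (sum_list (map fst js)) (sum_list (map fst js))"
  unfolding block_shift_poly_def carrier_mat_def mem_Collect_eq dim_diag_block_mat map_map comp_def
    shift_poly_dims map_fst_nth by simp

text \<open>This is where the eigenvalues of distinct blocks must differ: Hermite interpolation at the
  eigenvalues produces the polynomial.\<close>
lemma block_shift_poly_eq_poly_jordan_matrix:
  assumes "distinct (map snd js)"
  shows "\<exists>p. \<forall>i<sum_list (map fst js). \<forall>j<sum_list (map fst js).
    block_shift_poly js c $$ (i, j) = (\<Sum>r\<le>degree p. coeff p r * (jordan_matrix js ^\<^sub>m r) $$ (i, j))"
proof -
  obtain p where p: "coeff (pcompose p [:snd (js ! j), 1:]) l = c j l"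
    if "j < length js" "l < fst (js ! j)" for j l
    using exists_poly_taylor_coeffs[OF assms, of c] by auto
  have pow: "jordan_matrix js ^\<^sub>m r =
      diag_block_mat (map (\<lambda>j. jordan_block (fst (js ! j)) (snd (js ! j)) ^\<^sub>m r) [0..<length js])" for r
    unfolding jordan_matrix_pow
    by (rule arg_cong[of _ _ diag_block_mat], rule nth_equalityI) (auto simp: case_prod_beta)
  have "block_shift_poly js c $$ (i, j) = (\<Sum>r\<le>degree p. coeff p r * (jordan_matrix js ^\<^sub>m r) $$ (i, j))"
    if "i < sum_list (map fst js)" "j < sum_list (map fst js)" for i j
    unfolding block_shift_poly_def pow
  proof (rule diag_block_mat_lincomb[where d = "\<lambda>j. fst (js ! j)" and R = "{..degree p}" and a = "coeff p"
        and f = "\<lambda>j. shift_poly (fst (js ! j)) (c j)"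
        and g = "\<lambda>r j. jordan_block (fst (js ! j)) (snd (js ! j)) ^\<^sub>m r"])
    fix x assume "x \<in> set [0..<length js]"
    then have x: "x < length js" by simp
    show "shift_poly (fst (js ! x)) (c x) $$ (i, j) =
        (\<Sum>r\<le>degree p. coeff p r * (jordan_block (fst (js ! x)) (snd (js ! x)) ^\<^sub>m r) $$ (i, j))"
      if "i < fst (js ! x)" "j < fst (js ! x)" for i j
      using that x by (simp add: shift_poly_index jordan_block_poly_index p)
  next
    show "i < sum_list (map (\<lambda>j. fst (js ! j)) [0..<length js])"
      "j < sum_list (map (\<lambda>j. fst (js ! j)) [0..<length js])"
      unfolding map_fst_nth by fact+
  qed (auto intro!: carrier_matI)
  then show ?thesis by blast
qed

section \<open>Linear combinations of matrices under multiplication\<close>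

text \<open>Multiplication from both sides is linear in the middle factor. This carries a polynomial
  identity through conjugation by \<open>P_J\<close> and yields that a polynomial in a matrix
  commutes with its powers.\<close>

lemma mult_lincomb_index:
  fixes X :: "'a :: comm_ring_1 mat"
  assumes "G \<in> carrier_mat m n" "H \<in> carrier_mat n l"
    and "X \<in> carrier_mat n n" "\<And>r. Y r \<in> carrier_mat n n"
    and "\<And>i j. i < n \<Longrightarrow> j < n \<Longrightarrow> X $$ (i, j) = (\<Sum>r\<in>R. a r * Y r $$ (i, j))"
    and "i < m" "j < l"
  shows "(G * X * H) $$ (i, j) = (\<Sum>r\<in>R. a r * (G * Y r * H) $$ (i, j))"
proof -
  have ex: "(G * Z * H) $$ (i, j) = (\<Sum>u<n. \<Sum>v<n. G $$ (i, u) * (Z $$ (u, v) * H $$ (v, j)))"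
    if Z: "Z \<in> carrier_mat n n" for Z
    unfolding assoc_mult_mat[OF assms(1) Z assms(2)] using assms(1,2,6,7) Z
    by (simp add: scalar_prod_def sum_distrib_left atLeast0LessThan)
  have "(G * X * H) $$ (i, j) =
      (\<Sum>u<n. \<Sum>v<n. \<Sum>r\<in>R. a r * (G $$ (i, u) * (Y r $$ (u, v) * H $$ (v, j))))"
    unfolding ex[OF assms(3)]
    by (intro sum.cong refl) (simp add: assms(5) sum_distrib_left sum_distrib_right mult_ac)
  also have "\<dots> = (\<Sum>u<n. \<Sum>r\<in>R. \<Sum>v<n. a r * (G $$ (i, u) * (Y r $$ (u, v) * H $$ (v, j))))"
    by (intro sum.cong refl sum.swap)
  also have "\<dots> = (\<Sum>r\<in>R. \<Sum>u<n. \<Sum>v<n. a r * (G $$ (i, u) * (Y r $$ (u, v) * H $$ (v, j))))"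
    by (rule sum.swap)
  also have "\<dots> = (\<Sum>r\<in>R. a r * (G * Y r * H) $$ (i, j))"
    by (intro sum.cong refl) (simp add: ex[OF assms(4)] sum_distrib_left)
  finally show ?thesis .
qed

text \<open>The vector is treated as a matrix with one column, which reduces the claim to the
  two-sided matrix version.\<close>

lemma mult_lincomb_vec_index:
  fixes X :: "'a :: comm_ring_1 mat"
  assumes G: "G \<in> carrier_mat m n" and w: "w \<in> carrier_vec n"
    and X: "X \<in> carrier_mat n n" and Y: "\<And>r. Y r \<in> carrier_mat n n"
    and XY: "\<And>i j. i < n \<Longrightarrow> j < n \<Longrightarrow> X $$ (i, j) = (\<Sum>r\<in>R. a r * Y r $$ (i, j))"
    and i: "i < m"
  shows "((G * X) *\<^sub>v w) $ i = (\<Sum>r\<in>R. a r * ((G * Y r) *\<^sub>v w) $ i)"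
proof -
  define H where "H = mat_of_cols n [w]"
  have H: "H \<in> carrier_mat n 1" unfolding H_def by (intro carrier_matI) simp_all
  have c: "col H 0 = w" using col_mat_of_cols[of 0 "[w]" n] w by (simp add: H_def)
  have *: "((G * Z) *\<^sub>v w) $ i = (G * Z * H) $$ (i, 0)" if "Z \<in> carrier_mat n n" for Z
    by (subst index_mult_mat) (use G H i that in \<open>simp_all add: c\<close>)
  show ?thesis
    unfolding *[OF X] *[OF Y] by (rule mult_lincomb_index[OF G H X Y XY i]) auto
qed

section \<open>Rank and observable decomposition\<close>

text \<open>Full column rank makes the columns linearly independent, whereas a nonzero kernel vector
  would be a dependence between them.\<close>

lemma rank_eq_dim_col_imp_kernel_trivial:
  fixes M :: "'a :: field mat"
  assumes M: "M \<in> carrier_mat m l" and rank: "mat_rank M = l"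
    and z: "z \<in> carrier_vec l" and Mz: "M *\<^sub>v z = 0\<^sub>v m"
  shows "z = 0\<^sub>v l"
proof (rule ccontr)
  assume nz: "z \<noteq> 0\<^sub>v l"
  interpret vec_space "TYPE('a)" m .
  have rank: "rank M = l" using M rank by auto
  \<comment> \<open>Linear independence concerns the set of columns, so repetitions must be excluded
    first: a repeated column would leave fewer than \<open>l\<close> vectors for a maximal
    independent subset, whose size is the rank.\<close>
  have "distinct (cols M)"
  proof (rule ccontr)
    assume "\<not> distinct (cols M)"
    then have "card (set (cols M)) < l"
      using M card_distinct[of "cols M"] card_length[of "cols M"] by fastforce
    moreover obtain S where S: "maximal S (\<lambda>T. T \<subseteq> set (cols M) \<and> lin_indpt T)"
      using maximal_exists_superset[of "set (cols M)" "\<lambda>T. T \<subseteq> set (cols M) \<and> lin_indpt T" "{}"]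
        finite_lin_indpt2[of "{}"] by auto
    moreover have "card S \<le> card (set (cols M))"
      using S by (intro card_mono) (auto simp: maximal_def)
    ultimately show False
      using rank_card_indpt[OF M S] rank by simp
  qed
  then show False
    using lin_depI[OF M z nz Mz] full_rank_lin_indpt[OF M rank] by blast
qed

lemma stack_mats_carrier: "stack_mats l Ms \<in> carrier_mat (dim_row (stack_mats l Ms)) l"
  by (simp add: stack_mats_def)

lemma stack_mats_mult_vec_eq_zero:
  fixes Ms :: "'a :: semiring_0 mat list"
  assumes Ms: "\<And>M. M \<in> set Ms \<Longrightarrow> dim_col M = l \<and> (\<forall>i<dim_row M. (M *\<^sub>v z) $ i = 0)"
  shows "stack_mats l Ms *\<^sub>v z = 0\<^sub>v (dim_row (stack_mats l Ms))"
proof (rule eq_vecI)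
  fix i assume "i < dim_vec (0\<^sub>v (dim_row (stack_mats l Ms)))"
  then have i: "i < length (concat (map rows Ms))" by (simp add: stack_mats_def)
  define v where "v = concat (map rows Ms) ! i"
  have "v \<in> set (concat (map rows Ms))" unfolding v_def using i by (rule nth_mem)
  then obtain M j where M: "M \<in> set Ms" "j < dim_row M" "v = row M j"
    by (auto simp: rows_def)
  have "v \<in> carrier_vec l" using M Ms[OF M(1)] by auto
  then have "(stack_mats l Ms *\<^sub>v z) $ i = v \<bullet> z"
    using i unfolding v_def by (simp add: stack_mats_def)
  also have "\<dots> = 0" using Ms[OF M(1)] M(2,3) by simp
  finally show "(stack_mats l Ms *\<^sub>v z) $ i = 0\<^sub>v (dim_row (stack_mats l Ms)) $ i"
    using i by (simp add: stack_mats_def)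
qed simp

text \<open>In the decomposed coordinates the output sees only the leading components, and the zero
  upper right block keeps the remaining components from feeding into them. Hence all output
  coefficients depend only on the observable part of the state.\<close>

lemma observable_decomposition_pow:
  assumes decomp: "observable_decomposition A F P P' A_ob A21 A_unob F_ob"
    and A: "A \<in> carrier_mat n n" and F: "F \<in> carrier_mat r n" and v: "v \<in> carrier_vec n"
  shows "(F * A ^\<^sub>m k) *\<^sub>v v = (F_ob * A_ob ^\<^sub>m k) *\<^sub>v vec_first (P' *\<^sub>v v) (n - unobs_dim A F)"
proof -
  define p where "p = unobs_dim A F"
  define l where "l = n - p"
  define B where "B = four_block_mat A_ob (0\<^sub>m l p) A21 A_unob"
  have ob: "A_ob \<in> carrier_mat l l" "A21 \<in> carrier_mat p l" "A_unob \<in> carrier_mat p p"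
    "F_ob \<in> carrier_mat r l" and sim: "similar_mat_wit A B P P'"
    and FP: "F * P = append_cols F_ob (0\<^sub>m r p)"
    using decomp A F unfolding observable_decomposition_def Let_def B_def l_def p_def by auto
  note P = similar_mat_witD2[OF A sim]
  \<comment> \<open>Since \<open>l\<close> is defined by truncated subtraction,
    \<open>n = l + p\<close> is not immediate; it follows by comparing the size of the block matrix
    with that of \<open>A\<close>.\<close>
  have "B \<in> carrier_mat (l + p) (l + p)" unfolding B_def using ob(1,3) by simp
  then have n: "n = l + p" using P(5) by auto
  have F0: "append_cols F_ob (0\<^sub>m r p) \<in> carrier_mat r n"
    unfolding FP[symmetric] using F P(6) by (rule mult_carrier_mat)
  have Bk: "B ^\<^sub>m k \<in> carrier_mat n n" for k by (rule pow_carrier_mat[OF P(5)])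
  have append: "append_cols X (0\<^sub>m r p) = four_block_mat X (0\<^sub>m r p) (0\<^sub>m 0 l) (0\<^sub>m 0 p)"
    if "X \<in> carrier_mat r l" for X :: "real mat"
    using that by (simp add: append_cols_def)
  have blk: "append_cols F_ob (0\<^sub>m r p) * B ^\<^sub>m k = append_cols (F_ob * A_ob ^\<^sub>m k) (0\<^sub>m r p)"
  proof (induction k)
    case 0
    show ?case using ob P(5) F0 by simp
  next
    case (Suc k)
    have Ak: "A_ob ^\<^sub>m k \<in> carrier_mat l l" by (rule pow_carrier_mat[OF ob(1)])
    have X: "F_ob * A_ob ^\<^sub>m k \<in> carrier_mat r l" using Ak ob by simp
    have "append_cols F_ob (0\<^sub>m r p) * B ^\<^sub>m Suc k = append_cols F_ob (0\<^sub>m r p) * B ^\<^sub>m k * B"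
      unfolding pow_mat.simps(2) by (rule assoc_mult_mat[OF F0 Bk P(5), symmetric])
    also have "\<dots> = append_cols (F_ob * A_ob ^\<^sub>m k) (0\<^sub>m r p) * B" by (simp only: Suc.IH)
    also have "\<dots> = append_cols (F_ob * A_ob ^\<^sub>m k * A_ob) (0\<^sub>m r p)"
      unfolding append[OF X] append[OF mult_carrier_mat[OF X ob(1)]] B_def
        mult_four_block_mat[OF X zero_carrier_mat zero_carrier_mat zero_carrier_mat ob(1) zero_carrier_mat ob(2,3)]
      using X ob mult_carrier_mat[OF X ob(1)] by simp
    also have "F_ob * A_ob ^\<^sub>m k * A_ob = F_ob * A_ob ^\<^sub>m Suc k"
      unfolding pow_mat.simps(2) by (rule assoc_mult_mat[OF ob(4) Ak ob(1)])
    finally show ?case .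
  qed
  define w where "w = P' *\<^sub>v v"
  have w: "w \<in> carrier_vec (l + p)" unfolding w_def using P(7) v n by simp
  have X: "F_ob * A_ob ^\<^sub>m k \<in> carrier_mat r l" using pow_carrier_mat[OF ob(1)] ob by simp
  have "A ^\<^sub>m k = P * B ^\<^sub>m k * P'" by (rule similar_mat_wit_pow_id[OF sim])
  then have "(F * A ^\<^sub>m k) *\<^sub>v v = (F * P * B ^\<^sub>m k * P') *\<^sub>v v"
    by (simp only: assoc_mult_mat[OF F P(6) Bk] assoc_mult_mat[OF F mult_carrier_mat[OF P(6) Bk] P(7)])
  also have "\<dots> = (F * P * B ^\<^sub>m k) *\<^sub>v w"
    unfolding w_def
    by (rule assoc_mult_mat_vec[OF mult_carrier_mat[OF mult_carrier_mat[OF F P(6)] Bk] P(7) v])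
  also have "F * P * B ^\<^sub>m k = append_cols (F_ob * A_ob ^\<^sub>m k) (0\<^sub>m r p)"
    unfolding FP by (rule blk)
  also have "\<dots> *\<^sub>v w = (F_ob * A_ob ^\<^sub>m k) *\<^sub>v vec_first w l"
  proof -
    have "append_cols (F_ob * A_ob ^\<^sub>m k) (0\<^sub>m r p) *\<^sub>v (vec_first w l @\<^sub>v vec_last w p) =
        (F_ob * A_ob ^\<^sub>m k) *\<^sub>v vec_first w l"
      unfolding append[OF X]
        four_block_mat_mult_vec[OF X zero_carrier_mat zero_carrier_mat zero_carrier_mat vec_first_carrier vec_last_carrier]
      using X by (auto intro!: eq_vecI)
    then show ?thesis using w by simp
  qed
  finally show ?thesis unfolding w_def l_def p_def .
qed

section \<open>Matrix exponential and linear differential equations\<close>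

lemma smult_pow_mat:
  fixes M :: "'a :: comm_ring_1 mat"
  assumes M: "M \<in> carrier_mat n n"
  shows "(t \<cdot>\<^sub>m M) ^\<^sub>m k = t ^ k \<cdot>\<^sub>m (M ^\<^sub>m k)"
proof (induction k)
  case 0
  then show ?case by (auto intro!: eq_matI)
next
  case (Suc k)
  have Mk: "M ^\<^sub>m k \<in> carrier_mat n n" by (rule pow_carrier_mat[OF M])
  have "(t \<cdot>\<^sub>m M) ^\<^sub>m Suc k = (t ^ k \<cdot>\<^sub>m (M ^\<^sub>m k)) * (t \<cdot>\<^sub>m M)"
    by (simp add: Suc.IH)
  also have "\<dots> = t ^ k \<cdot>\<^sub>m (M ^\<^sub>m k * (t \<cdot>\<^sub>m M))"
    using M Mk by (intro mult_smult_assoc_mat) auto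
  also have "M ^\<^sub>m k * (t \<cdot>\<^sub>m M) = t \<cdot>\<^sub>m (M ^\<^sub>m k * M)"
    using M Mk by (intro mult_smult_distrib) auto
  also have "t ^ k \<cdot>\<^sub>m (t \<cdot>\<^sub>m (M ^\<^sub>m k * M)) = t ^ Suc k \<cdot>\<^sub>m (M ^\<^sub>m Suc k)"
    by (rule eq_matI) auto
  finally show ?case .
qed

lemma mult_mat_vec_index:
  assumes "X \<in> carrier_mat m n" "v \<in> carrier_vec n" "i < m"
  shows "(X *\<^sub>v v) $ i = (\<Sum>j<n. X $$ (i, j) * v $ j)"
  using assms by (simp add: scalar_prod_def atLeast0LessThan)

text \<open>Each further factor contributes \<open>n\<close> products, each enlarged by at most
  \<open>c\<close>. Geometric growth is enough, because the factorials in the exponential series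
  dominate it.\<close>

lemma pow_mat_entry_bound:
  fixes M :: "real mat"
  assumes M: "M \<in> carrier_mat n n"
    and c: "\<And>i j. i < n \<Longrightarrow> j < n \<Longrightarrow> \<bar>M $$ (i, j)\<bar> \<le> c"
    and "i < n" "j < n"
  shows "\<bar>(M ^\<^sub>m k) $$ (i, j)\<bar> \<le> (real n * c) ^ k"
  using assms(3,4)
proof (induction k arbitrary: i j)
  case 0
  then show ?case using M by simp
next
  case (Suc k)
  have "0 \<le> c" using c[OF Suc.prems] by linarith
  have Mk: "M ^\<^sub>m k \<in> carrier_mat n n" by (rule pow_carrier_mat[OF M])
  have "(M ^\<^sub>m Suc k) $$ (i, j) = (\<Sum>l<n. (M ^\<^sub>m k) $$ (i, l) * M $$ (l, j))"
    using M Mk Suc.prems by (simp add: scalar_prod_def atLeast0LessThan)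
  also have "\<bar>\<dots>\<bar> \<le> (\<Sum>l<n. \<bar>(M ^\<^sub>m k) $$ (i, l) * M $$ (l, j)\<bar>)"
    by (rule sum_abs)
  also have "\<dots> \<le> (\<Sum>l<n. (real n * c) ^ k * c)"
    unfolding abs_mult using Suc.IH Suc.prems c \<open>0 \<le> c\<close> by (intro sum_mono mult_mono) auto
  also have "\<dots> = (real n * c) ^ Suc k" by simp
  finally show ?case .
qed

lemma mat_entry_bound:
  fixes M :: "real mat"
  shows "\<exists>c\<ge>0. \<forall>i<n. \<forall>j<n. \<bar>M $$ (i, j)\<bar> \<le> c"
proof (intro exI conjI allI impI)
  show "0 \<le> (\<Sum>i<n. \<Sum>j<n. \<bar>M $$ (i, j)\<bar>)" by (intro sum_nonneg) auto
  fix i j assume "i < n" "j < n"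
  then have "\<bar>M $$ (i, j)\<bar> \<le> (\<Sum>j<n. \<bar>M $$ (i, j)\<bar>)" by (intro member_le_sum) auto
  also have "\<dots> \<le> (\<Sum>i<n. \<Sum>j<n. \<bar>M $$ (i, j)\<bar>)"
    using \<open>i < n\<close> by (intro member_le_sum[of _ _ "\<lambda>i. \<Sum>j<n. \<bar>M $$ (i, j)\<bar>"]) (auto intro: sum_nonneg)
  finally show "\<bar>M $$ (i, j)\<bar> \<le> (\<Sum>i<n. \<Sum>j<n. \<bar>M $$ (i, j)\<bar>)" .
qed

text \<open>The entries of \<open>mat_exp\<close> are defined as infinite sums, which carry
  information only once convergence is known; comparison with a scalar exponential series provides
  it.\<close>

lemma mat_exp_entry_sums:
  assumes M: "M \<in> carrier_mat n n" and ij: "i < n" "j < n"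
  shows "(\<lambda>k. (M ^\<^sub>m k) $$ (i, j) / fact k) sums mat_exp M $$ (i, j)"
proof -
  obtain c where c: "\<And>i j. i < n \<Longrightarrow> j < n \<Longrightarrow> \<bar>M $$ (i, j)\<bar> \<le> c"
    using mat_entry_bound[of n M] by auto
  have "summable (\<lambda>k. (real n * c) ^ k / fact k)"
    using summable_exp[of "real n * c"] by (simp add: divide_inverse mult.commute)
  moreover have "norm ((M ^\<^sub>m k) $$ (i, j) / fact k) \<le> (real n * c) ^ k / fact k" for k
    using pow_mat_entry_bound[OF M c ij] by (simp add: divide_right_mono)
  ultimately have "summable (\<lambda>k. (M ^\<^sub>m k) $$ (i, j) / fact k)"
    by (rule summable_comparison_test'[where N = 0])
  then show ?thesis using M ij unfolding mat_exp_def by (simp add: summable_sums)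
qed

text \<open>Expresses an output of the exponential as a power series in \<open>t\<close> whose
  coefficients involve only \<open>X * M ^\<^sub>m k\<close> applied to \<open>v\<close>. Outputs of
  different systems can then be compared coefficient by coefficient.\<close>

lemma mat_exp_mult_vec_sums:
  assumes X: "X \<in> carrier_mat m n" and M: "M \<in> carrier_mat n n" and v: "v \<in> carrier_vec n"
    and i: "i < m"
  shows "(\<lambda>k. t ^ k / fact k * ((X * M ^\<^sub>m k) *\<^sub>v v) $ i) sums (((X * mat_exp (t \<cdot>\<^sub>m M)) *\<^sub>v v) $ i)"
proof -
  have tM: "t \<cdot>\<^sub>m M \<in> carrier_mat n n" using M by simp
  have E: "mat_exp (t \<cdot>\<^sub>m M) \<in> carrier_mat n n" using M by (simp add: mat_exp_def)
  have ex: "((X * Y) *\<^sub>v v) $ i = (\<Sum>l<n. \<Sum>j<n. X $$ (i, l) * (Y $$ (l, j) * v $ j))"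
    if Y: "Y \<in> carrier_mat n n" for Y
  proof -
    have "((X * Y) *\<^sub>v v) $ i = (X *\<^sub>v (Y *\<^sub>v v)) $ i"
      by (simp add: assoc_mult_mat_vec[OF X Y v])
    also have "\<dots> = (\<Sum>l<n. X $$ (i, l) * (\<Sum>j<n. Y $$ (l, j) * v $ j))"
      using mult_mat_vec_index[OF X mult_mat_vec_carrier[OF Y v] i] mult_mat_vec_index[OF Y v] by simp
    finally show ?thesis by (simp add: sum_distrib_left)
  qed
  have "(\<lambda>k. \<Sum>l<n. \<Sum>j<n. X $$ (i, l) * (((t \<cdot>\<^sub>m M) ^\<^sub>m k) $$ (l, j) / fact k * v $ j)) sums
      (\<Sum>l<n. \<Sum>j<n. X $$ (i, l) * (mat_exp (t \<cdot>\<^sub>m M) $$ (l, j) * v $ j))"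
    by (intro sums_sum sums_mult sums_mult2 mat_exp_entry_sums[OF tM]) auto
  moreover have "(\<Sum>l<n. \<Sum>j<n. X $$ (i, l) * (((t \<cdot>\<^sub>m M) ^\<^sub>m k) $$ (l, j) / fact k * v $ j)) =
      t ^ k / fact k * ((X * M ^\<^sub>m k) *\<^sub>v v) $ i" for k
    unfolding ex[OF pow_carrier_mat[OF M]] smult_pow_mat[OF M] sum_distrib_left
    using carrier_matD[OF pow_carrier_mat[OF M, of k]] by (intro sum.cong refl) simp
  ultimately show ?thesis by (simp add: ex[OF E])
qed

text \<open>The integral equation makes \<open>e\<close> smooth with \<open>k\<close>-th derivative \<open>M\<^sup>k e\<close>, so that Taylor's
  theorem applies and no uniqueness theorem for ordinary differential equations is needed.\<close>
lemma linear_ode_sums: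
  fixes e :: "real \<Rightarrow> real vec"
  assumes M: "M \<in> carrier_mat n n" and T: "0 \<le> T"
    and e: "\<And>s. 0 \<le> s \<Longrightarrow> s \<le> T \<Longrightarrow> e s \<in> carrier_vec n"
    and int: "\<And>t i. 0 \<le> t \<Longrightarrow> t \<le> T \<Longrightarrow> i < n \<Longrightarrow>
      ((\<lambda>s. (M *\<^sub>v e s) $ i) has_integral (e t $ i - e 0 $ i)) {0..t}"
    and i: "i < n"
  shows "(\<lambda>k. T ^ k / fact k * ((M ^\<^sub>m k) *\<^sub>v e 0) $ i) sums (e T $ i)"
proof -
  have e_eq: "e t $ i = e 0 $ i + integral {0..t} (\<lambda>s. (M *\<^sub>v e s) $ i)"
    if "t \<in> {0..T}" "i < n" for t i
    using integral_unique[OF int[of t i]] that by simp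
  \<comment> \<open>An indefinite integral is continuous as soon as its integrand is integrable, so
    no regularity of \<open>e\<close> has to be known beforehand.\<close>
  have cont: "continuous_on {0..T} (\<lambda>t. e t $ i)" if "i < n" for i
  proof -
    have "continuous_on {0..T} (\<lambda>t. e 0 $ i + integral {0..t} (\<lambda>s. (M *\<^sub>v e s) $ i))"
      using int[of T i] T that
      by (intro continuous_intros indefinite_integral_continuous_1) (auto simp: integrable_on_def)
    then show ?thesis by (rule continuous_on_eq) (rule e_eq[OF _ that, symmetric])
  qed
  have Xe: "(X *\<^sub>v e t) $ i = (\<Sum>j<n. X $$ (i, j) * e t $ j)"
    if "X \<in> carrier_mat n n" "t \<in> {0..T}" "i < n" for X i t
    using that e by (intro mult_mat_vec_index) auto
  have contX: "continuous_on {0..T} (\<lambda>t. (X *\<^sub>v e t) $ i)" if "X \<in> carrier_mat n n" "i < n" for X i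
  proof -
    have "continuous_on {0..T} (\<lambda>t. \<Sum>j<n. X $$ (i, j) * e t $ j)"
      by (intro continuous_intros cont) auto
    then show ?thesis by (rule continuous_on_eq) (simp add: Xe that)
  qed
  \<comment> \<open>The integrand is now known to be continuous, so the fundamental theorem of
    calculus applies, one-sidedly at the end points.\<close>
  have deriv: "((\<lambda>t. e t $ i) has_vector_derivative (M *\<^sub>v e t) $ i) (at t within {0..T})"
    if t: "t \<in> {0..T}" and "i < n" for t i
  proof (rule has_vector_derivative_transform[OF t])
    show "((\<lambda>t. e 0 $ i + integral {0..t} (\<lambda>s. (M *\<^sub>v e s) $ i)) has_vector_derivative
        (M *\<^sub>v e t) $ i) (at t within {0..T})"
      using integral_has_vector_derivative[OF contX[OF M \<open>i < n\<close>] t]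
      by (auto intro!: derivative_eq_intros)
  qed (rule e_eq[OF _ \<open>i < n\<close>])
  have Mk: "M ^\<^sub>m k \<in> carrier_mat n n" for k by (rule pow_carrier_mat[OF M])
  have derivM: "((\<lambda>t. (M ^\<^sub>m k *\<^sub>v e t) $ i) has_vector_derivative (M ^\<^sub>m Suc k *\<^sub>v e t) $ i)
      (at t within {0..T})" if t: "t \<in> {0..T}" for k t
  proof (rule has_vector_derivative_transform[OF t])
    have "e t \<in> carrier_vec n" using t e by auto
    then have "M ^\<^sub>m Suc k *\<^sub>v e t = M ^\<^sub>m k *\<^sub>v (M *\<^sub>v e t)"
      using assoc_mult_mat_vec[OF Mk M] by simp
    then have "(M ^\<^sub>m Suc k *\<^sub>v e t) $ i = (\<Sum>j<n. (M ^\<^sub>m k) $$ (i, j) * (M *\<^sub>v e t) $ j)"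
      using mult_mat_vec_index[OF Mk mult_mat_vec_carrier[OF M \<open>e t \<in> carrier_vec n\<close>] i] by simp
    then show "((\<lambda>t. \<Sum>j<n. (M ^\<^sub>m k) $$ (i, j) * e t $ j) has_vector_derivative
        (M ^\<^sub>m Suc k *\<^sub>v e t) $ i) (at t within {0..T})"
      using deriv[OF t] by (auto intro!: derivative_eq_intros has_vector_derivative_sum sum.cong)
  qed (simp add: Xe[OF Mk _ i])
  obtain c where c: "0 \<le> c" "\<And>i j. i < n \<Longrightarrow> j < n \<Longrightarrow> \<bar>M $$ (i, j)\<bar> \<le> c"
    using mat_entry_bound[of n M] by auto
  have "\<exists>b. \<forall>t\<in>{0..T}. \<bar>e t $ j\<bar> \<le> b" if "j < n" for j
    using compact_imp_bounded[OF compact_continuous_image[OF cont[OF that] compact_Icc]]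
    by (auto simp: bounded_iff)
  then obtain b where b: "\<bar>e t $ j\<bar> \<le> b j" if "t \<in> {0..T}" "j < n" for j t
    by metis
  define K where "K = (\<Sum>j<n. \<bar>b j\<bar>)"
  have K: "0 \<le> K" unfolding K_def by (intro sum_nonneg) auto
  have bound: "\<bar>(M ^\<^sub>m k *\<^sub>v e t) $ i\<bar> \<le> (real n * c) ^ k * K" if t: "t \<in> {0..T}" for k t
  proof -
    have "\<bar>(M ^\<^sub>m k *\<^sub>v e t) $ i\<bar> \<le> (\<Sum>j<n. \<bar>(M ^\<^sub>m k) $$ (i, j) * e t $ j\<bar>)"
      unfolding Xe[OF Mk t i] by (rule sum_abs)
    also have "\<dots> \<le> (\<Sum>j<n. (real n * c) ^ k * \<bar>b j\<bar>)"
      unfolding abs_mult using pow_mat_entry_bound[OF M c(2) i] order_trans[OF b[OF t] abs_ge_self] c(1)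
      by (intro sum_mono mult_mono) auto
    finally show ?thesis by (simp add: K_def sum_distrib_left)
  qed
  \<comment> \<open>The integral form of the Taylor remainder is bounded by the maximum of its
    integrand times the interval length \<open>T\<close>. The result is a constant times the p-th
    term of an exponential series, which tends to 0.\<close>
  have rem: "\<bar>e T $ i - (\<Sum>k<Suc p. T ^ k / fact k * (M ^\<^sub>m k *\<^sub>v e 0) $ i)\<bar> \<le>
      (real n * c) * K * T * ((real n * c * T) ^ p / fact p)" for p
  proof -
    have M0: "(M ^\<^sub>m 0 *\<^sub>v e t) $ i = e t $ i" if "t \<in> {0..T}" for t
      using e[of t] M that by simp
    have "((\<lambda>x. ((T - x) ^ (Suc p - 1) / fact (Suc p - 1)) *\<^sub>R (M ^\<^sub>m Suc p *\<^sub>v e x) $ i) has_integral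
        (M ^\<^sub>m 0 *\<^sub>v e T) $ i - (\<Sum>k<Suc p. ((T - 0) ^ k / fact k) *\<^sub>R (M ^\<^sub>m k *\<^sub>v e 0) $ i)) (cbox 0 T)"
      unfolding cbox_interval by (rule Taylor_has_integral[where Df = "\<lambda>k t. (M ^\<^sub>m k *\<^sub>v e t) $ i"])
        (use derivM T in auto)
    then have "norm ((M ^\<^sub>m 0 *\<^sub>v e T) $ i - (\<Sum>k<Suc p. ((T - 0) ^ k / fact k) *\<^sub>R (M ^\<^sub>m k *\<^sub>v e 0) $ i))
        \<le> (T ^ p / fact p * ((real n * c) ^ Suc p * K)) * measure lborel (cbox 0 T)"
    proof (rule has_integral_bound[rotated])
      show "0 \<le> T ^ p / fact p * ((real n * c) ^ Suc p * K)" using T c(1) K by simp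
      fix x assume "x \<in> cbox 0 T"
      then have x: "x \<in> {0..T}" by simp
      then have "(T - x) ^ p \<le> T ^ p" by (intro power_mono) auto
      then show "norm (((T - x) ^ (Suc p - 1) / fact (Suc p - 1)) *\<^sub>R (M ^\<^sub>m Suc p *\<^sub>v e x) $ i)
          \<le> T ^ p / fact p * ((real n * c) ^ Suc p * K)"
        using bound[OF x, of "Suc p"] x T
        by (auto simp: abs_mult power_abs simp del: power_Suc pow_mat.simps intro!: mult_mono divide_right_mono)
    qed
    then show ?thesis using T M0[of T] by (simp add: power_mult_distrib mult_ac)
  qed
  have "(\<lambda>p. (real n * c) * K * T * ((real n * c * T) ^ p / fact p)) \<longlonglongrightarrow> (real n * c) * K * T * 0"
  proof (intro tendsto_mult tendsto_const)
    have "summable (\<lambda>p. (real n * c * T) ^ p / fact p)"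
      using summable_exp[of "real n * c * T"] by (simp add: divide_inverse mult.commute)
    then show "(\<lambda>p. (real n * c * T) ^ p / fact p) \<longlonglongrightarrow> 0" by (rule summable_LIMSEQ_zero)
  qed
  then have lim: "(\<lambda>p. (real n * c) * K * T * ((real n * c * T) ^ p / fact p)) \<longlonglongrightarrow> 0" by simp
  have "(\<lambda>p. e T $ i - (\<Sum>k<Suc p. T ^ k / fact k * (M ^\<^sub>m k *\<^sub>v e 0) $ i)) \<longlonglongrightarrow> 0"
    by (rule Lim_null_comparison[OF _ lim], unfold real_norm_def) (intro always_eventually allI rem)
  then have "(\<lambda>p. \<Sum>k<Suc p. T ^ k / fact k * (M ^\<^sub>m k *\<^sub>v e 0) $ i) \<longlonglongrightarrow> e T $ i"
    using tendsto_diff[OF tendsto_const[of "e T $ i"]] by fastforce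
  then show ?thesis unfolding sums_def by (rule LIMSEQ_imp_Suc)
qed

section \<open>Transfer from \<open>C\<close> to \<open>F\<close>\<close>

lemma pow_mat_add:
  fixes A :: "'a :: semiring_1 mat"
  assumes A: "A \<in> carrier_mat n n"
  shows "A ^\<^sub>m (k + l) = A ^\<^sub>m k * A ^\<^sub>m l"
proof (induction l)
  case 0
  show ?case using pow_carrier_mat[OF A, of k] A by simp
next
  case (Suc l)
  then show ?case
    using assoc_mult_mat[OF pow_carrier_mat[OF A, of k] pow_carrier_mat[OF A, of l] A] by simp
qed

text \<open>A real matrix acts separately on real and imaginary parts; this leads from the complex
  Jordan coordinates back to real states.\<close>

lemma Re_Im_mult_mat_vec:
  assumes M: "M \<in> carrier_mat m n" and w: "w \<in> carrier_vec n" and i: "i < m"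
  shows "Re ((map_mat complex_of_real M *\<^sub>v w) $ i) = (M *\<^sub>v map_vec Re w) $ i"
    and "Im ((map_mat complex_of_real M *\<^sub>v w) $ i) = (M *\<^sub>v map_vec Im w) $ i"
proof -
  have cM: "map_mat complex_of_real M \<in> carrier_mat m n" and Rew: "map_vec Re w \<in> carrier_vec n"
    and Imw: "map_vec Im w \<in> carrier_vec n" using M w by auto
  show "Re ((map_mat complex_of_real M *\<^sub>v w) $ i) = (M *\<^sub>v map_vec Re w) $ i"
    unfolding mult_mat_vec_index[OF cM w i] mult_mat_vec_index[OF M Rew i] using M w i by simp
  show "Im ((map_mat complex_of_real M *\<^sub>v w) $ i) = (M *\<^sub>v map_vec Im w) $ i"
    unfolding mult_mat_vec_index[OF cM w i] mult_mat_vec_index[OF M Imw i] using M w i by simp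
qed

text \<open>\<open>S\<close> stands for \<open>P\<^sub>J Q P\<^sub>J\<^sup>-\<^sup>1\<close> and \<open>G\<close> for \<open>\<alpha> C\<close>.  Since \<open>F A\<^sup>k S\<^sup>-\<^sup>1 e = G A\<^sup>k e\<close> is real, the
  imaginary part of \<open>S\<^sup>-\<^sup>1 e\<close> is unobservable; \<open>z\<close> is the observable component of its real part.\<close>
lemma observable_part_of_transformed_state:
  fixes A F G :: "real mat"
  defines "cA \<equiv> map_mat complex_of_real A" and "cF \<equiv> map_mat complex_of_real F"
    and "cG \<equiv> map_mat complex_of_real G"
  assumes A: "A \<in> carrier_mat n n" and F: "F \<in> carrier_mat r n" and G: "G \<in> carrier_mat r n"
    and S: "S \<in> carrier_mat n n" and T: "T \<in> carrier_mat n n" and ST: "S * T = 1\<^sub>m n"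
    and cF_eq: "cF = cG * S"
    and poly: "\<And>i j. i < n \<Longrightarrow> j < n \<Longrightarrow> S $$ (i, j) = (\<Sum>l\<in>R. a l * (cA ^\<^sub>m l) $$ (i, j))"
    and decomp: "observable_decomposition A F P P' A_ob A21 A_unob F_ob"
    and e: "e \<in> carrier_vec n"
  shows "\<exists>z\<in>carrier_vec (n - unobs_dim A F).
    (\<forall>k. (G * A ^\<^sub>m k) *\<^sub>v e = (F_ob * A_ob ^\<^sub>m k) *\<^sub>v z) \<and>
    (z = 0\<^sub>v (n - unobs_dim A F) \<longrightarrow> (\<forall>k. (F * A ^\<^sub>m k) *\<^sub>v e = 0\<^sub>v r))"
proof -
  have cA: "cA \<in> carrier_mat n n" and cF: "cF \<in> carrier_mat r n" and cG: "cG \<in> carrier_mat r n"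
    unfolding cA_def cF_def cG_def using A F G by auto
  note cAk = pow_carrier_mat[OF cA] and Ak = pow_carrier_mat[OF A]
  define ce where "ce = map_vec complex_of_real e"
  define w where "w = T *\<^sub>v ce"
  have ce: "ce \<in> carrier_vec n" unfolding ce_def using e by simp
  have w: "w \<in> carrier_vec n" unfolding w_def by (rule mult_mat_vec_carrier[OF T ce])
  have Sw: "S *\<^sub>v w = ce"
    unfolding w_def assoc_mult_mat_vec[OF S T ce, symmetric] ST using ce by simp
  have hom: "map_mat complex_of_real (X * A ^\<^sub>m k) = map_mat complex_of_real X * cA ^\<^sub>m k"
    if "X \<in> carrier_mat r n" for X k
    unfolding cA_def of_real_hom.mat_hom_mult[OF that Ak] of_real_hom.mat_hom_pow[OF A] ..
  \<comment> \<open>\<open>S\<close> is a polynomial in \<open>cA\<close>, and powers of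
    \<open>cA\<close> commute. The identity matrices only bring both products into the three-factor
    form of the linearity lemma.\<close>
  have comm: "S * cA ^\<^sub>m k = cA ^\<^sub>m k * S" for k
  proof (rule eq_matI)
    fix i j assume "i < dim_row (cA ^\<^sub>m k * S)" "j < dim_col (cA ^\<^sub>m k * S)"
    then have ij: "i < n" "j < n" using cAk[of k] S by auto
    have "(S * cA ^\<^sub>m k) $$ (i, j) = (1\<^sub>m n * S * cA ^\<^sub>m k) $$ (i, j)" using S by simp
    also have "\<dots> = (\<Sum>l\<in>R. a l * (1\<^sub>m n * cA ^\<^sub>m l * cA ^\<^sub>m k) $$ (i, j))"
      by (rule mult_lincomb_index[OF one_carrier_mat cAk S cAk poly ij])
    also have "\<dots> = (\<Sum>l\<in>R. a l * (cA ^\<^sub>m k * cA ^\<^sub>m l * 1\<^sub>m n) $$ (i, j))"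
    proof (intro sum.cong refl)
      fix l
      have "1\<^sub>m n * cA ^\<^sub>m l * cA ^\<^sub>m k = cA ^\<^sub>m (l + k)"
        unfolding pow_mat_add[OF cA] left_mult_one_mat[OF cAk] ..
      also have "\<dots> = cA ^\<^sub>m k * cA ^\<^sub>m l * 1\<^sub>m n"
        unfolding add.commute[of l k] pow_mat_add[OF cA] right_mult_one_mat[OF mult_carrier_mat[OF cAk cAk]] ..
      finally show "a l * (1\<^sub>m n * cA ^\<^sub>m l * cA ^\<^sub>m k) $$ (i, j) = a l * (cA ^\<^sub>m k * cA ^\<^sub>m l * 1\<^sub>m n) $$ (i, j)"
        by simp
    qed
    also have "\<dots> = (cA ^\<^sub>m k * S * 1\<^sub>m n) $$ (i, j)"
      by (rule mult_lincomb_index[OF cAk one_carrier_mat S cAk poly ij, symmetric])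
    also have "\<dots> = (cA ^\<^sub>m k * S) $$ (i, j)"
      unfolding right_mult_one_mat[OF mult_carrier_mat[OF cAk S]] ..
    finally show "(S * cA ^\<^sub>m k) $$ (i, j) = (cA ^\<^sub>m k * S) $$ (i, j)" .
  qed (use S cAk[of k] in auto)
  \<comment> \<open>Here F = G S, the commutation of \<open>S\<close> with powers of A, and S w = e
    combine: the F-outputs of \<open>w\<close> are the G-outputs of \<open>e\<close>.\<close>
  have key: "map_mat complex_of_real (F * A ^\<^sub>m k) *\<^sub>v w = map_vec complex_of_real ((G * A ^\<^sub>m k) *\<^sub>v e)" for k
  proof -
    have "map_mat complex_of_real (F * A ^\<^sub>m k) *\<^sub>v w = (cG * S * cA ^\<^sub>m k) *\<^sub>v w"
      unfolding hom[OF F] cF_eq[symmetric] cF_def ..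
    also have "cG * S * cA ^\<^sub>m k = cG * cA ^\<^sub>m k * S"
      unfolding assoc_mult_mat[OF cG S cAk] comm assoc_mult_mat[OF cG cAk S] ..
    also have "\<dots> *\<^sub>v w = (cG * cA ^\<^sub>m k) *\<^sub>v ce"
      unfolding assoc_mult_mat_vec[OF mult_carrier_mat[OF cG cAk] S w] Sw ..
    also have "\<dots> = map_vec complex_of_real ((G * A ^\<^sub>m k) *\<^sub>v e)"
      unfolding ce_def cG_def hom[OF G, symmetric]
        of_real_hom.mult_mat_vec_hom[OF mult_carrier_mat[OF G Ak] e] ..
    finally show ?thesis .
  qed
  define x where "x = map_vec Re w"
  define y where "y = map_vec Im w"
  have x: "x \<in> carrier_vec n" and y: "y \<in> carrier_vec n" unfolding x_def y_def using w by auto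
  note FAk = mult_carrier_mat[OF F Ak] and GAk = mult_carrier_mat[OF G Ak]
  have Fx: "(F * A ^\<^sub>m k) *\<^sub>v x = (G * A ^\<^sub>m k) *\<^sub>v e" for k
  proof (rule eq_vecI)
    fix i assume "i < dim_vec ((G * A ^\<^sub>m k) *\<^sub>v e)"
    then have i: "i < r" using G by simp
    show "((F * A ^\<^sub>m k) *\<^sub>v x) $ i = ((G * A ^\<^sub>m k) *\<^sub>v e) $ i"
      unfolding x_def Re_Im_mult_mat_vec(1)[OF FAk w i, symmetric] key using i G by simp
  qed (use F G in simp)
  have Fy: "((F * A ^\<^sub>m k) *\<^sub>v y) $ i = 0" if i: "i < r" for i k
    unfolding y_def Re_Im_mult_mat_vec(2)[OF FAk w i, symmetric] key using i G by simp
  define l where "l = n - unobs_dim A F"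
  define z where "z = vec_first (P' *\<^sub>v x) l"
  have Fz: "(F * A ^\<^sub>m k) *\<^sub>v x = (F_ob * A_ob ^\<^sub>m k) *\<^sub>v z" for k
    unfolding z_def l_def by (rule observable_decomposition_pow[OF decomp A F x])
  have "(F * A ^\<^sub>m k) *\<^sub>v e = 0\<^sub>v r" if z0: "z = 0\<^sub>v l" for k
  proof (rule eq_vecI)
    have ob: "F_ob \<in> carrier_mat r l" "A_ob \<in> carrier_mat l l"
      using decomp A F unfolding observable_decomposition_def Let_def l_def by auto
    have Fx0: "((F * A ^\<^sub>m k) *\<^sub>v x) $ i = 0" if "i < r" for i k
      unfolding Fz z0
        mult_mat_vec_index[OF mult_carrier_mat[OF ob(1) pow_carrier_mat[OF ob(2)]] zero_carrier_vec that]
      by simp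
    have Fw: "((cF * cA ^\<^sub>m k) *\<^sub>v w) $ i = 0" if i: "i < r" for i k
      unfolding cF_def hom[OF F, symmetric]
      by (rule complex_eqI)
        (simp_all add: Re_Im_mult_mat_vec[OF FAk w i] Fx0[OF i] Fy[OF i] x_def[symmetric] y_def[symmetric]
          del: index_mult_mat_vec)
    fix i assume "i < dim_vec (0\<^sub>v r)"
    then have i: "i < r" by simp
    have FA: "cF * cA ^\<^sub>m k \<in> carrier_mat r n" by (rule mult_carrier_mat[OF cF cAk])
    \<comment> \<open>As e = S w and \<open>S\<close> is a polynomial in A, the vector F A^k e is a
      combination of the vectors F A^(k+l) w, all of which vanish.\<close>
    have "map_vec complex_of_real ((F * A ^\<^sub>m k) *\<^sub>v e) $ i = ((cF * cA ^\<^sub>m k) *\<^sub>v (S *\<^sub>v w)) $ i"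
      unfolding Sw ce_def of_real_hom.mult_mat_vec_hom[OF FAk e] hom[OF F] cF_def ..
    also have "\<dots> = ((cF * cA ^\<^sub>m k * S) *\<^sub>v w) $ i"
      unfolding assoc_mult_mat_vec[OF FA S w] ..
    also have "\<dots> = (\<Sum>l\<in>R. a l * ((cF * cA ^\<^sub>m k * cA ^\<^sub>m l) *\<^sub>v w) $ i)"
      by (rule mult_lincomb_vec_index[OF FA w S cAk poly i])
    also have "\<dots> = 0"
      unfolding assoc_mult_mat[OF cF cAk cAk] pow_mat_add[OF cA, symmetric] Fw[OF i] by simp
    finally show "((F * A ^\<^sub>m k) *\<^sub>v e) $ i = 0\<^sub>v r $ i" using i F by simp
  qed (use F in simp)
  then show ?thesis
    unfolding l_def[symmetric]
    by (intro bexI[of _ z]) (auto simp: Fz Fx[symmetric] z_def)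
qed

section \<open>Reconstruction\<close>

text \<open>Gives outputs of a solution the same series form as outputs of the matrix exponential,
  so equality of coefficients turns into equality of outputs.\<close>

lemma linear_ode_mult_sums:
  fixes e :: "real \<Rightarrow> real vec"
  assumes X: "X \<in> carrier_mat m n" and M: "M \<in> carrier_mat n n" and T: "0 \<le> T"
    and e: "\<And>s. 0 \<le> s \<Longrightarrow> s \<le> T \<Longrightarrow> e s \<in> carrier_vec n"
    and int: "\<And>t i. 0 \<le> t \<Longrightarrow> t \<le> T \<Longrightarrow> i < n \<Longrightarrow>
      ((\<lambda>s. (M *\<^sub>v e s) $ i) has_integral (e t $ i - e 0 $ i)) {0..t}"
    and i: "i < m"
  shows "(\<lambda>k. T ^ k / fact k * ((X * M ^\<^sub>m k) *\<^sub>v e 0) $ i) sums ((X *\<^sub>v e T) $ i)"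
proof -
  have e0: "e 0 \<in> carrier_vec n" and eT: "e T \<in> carrier_vec n" using e T by auto
  note Mk = pow_carrier_mat[OF M]
  have "(\<lambda>k. \<Sum>j<n. X $$ (i, j) * (T ^ k / fact k * (M ^\<^sub>m k *\<^sub>v e 0) $ j)) sums
      (\<Sum>j<n. X $$ (i, j) * e T $ j)"
    by (intro sums_sum sums_mult linear_ode_sums[OF M T e int]) auto
  moreover have "(\<Sum>j<n. X $$ (i, j) * (T ^ k / fact k * (M ^\<^sub>m k *\<^sub>v e 0) $ j)) =
      T ^ k / fact k * ((X * M ^\<^sub>m k) *\<^sub>v e 0) $ i" for k
    unfolding assoc_mult_mat_vec[OF X Mk e0] mult_mat_vec_index[OF X mult_mat_vec_carrier[OF Mk e0] i]
      sum_distrib_left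
    by (intro sum.cong refl) (simp only: mult_ac)
  ultimately show ?thesis
    unfolding mult_mat_vec_index[OF X eT i] by simp
qed

text \<open>If the data determine the value, a reconstruction map can be chosen: it takes any
  trajectory that fits the data and reads off its value. On data that fit no trajectory its value is
  arbitrary.\<close>

lemma exists_reconstruction:
  assumes "\<And>x0 u x x0' u' x' t. Tr x0 u x \<Longrightarrow> Tr x0' u' x' \<Longrightarrow> g u = g u' \<Longrightarrow> h u x = h u' x' \<Longrightarrow>
    t \<in> I \<Longrightarrow> f x t = f x' t"
  shows "\<exists>R. \<forall>x0 u x. Tr x0 u x \<longrightarrow> (\<forall>t\<in>I. f x t = R (g u) (h u x) t)"
proof (intro exI allI impI ballI)
  fix x0 u x t
  assume Tr: "Tr x0 u x" and t: "t \<in> I"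
  have "\<exists>w. \<exists>x0' u' x'. Tr x0' u' x' \<and> g u' = g u \<and> h u' x' = h u x \<and> w = f x' t"
    using Tr by blast
  then have "\<exists>x0' u' x'. Tr x0' u' x' \<and> g u' = g u \<and> h u' x' = h u x \<and>
      (SOME w. \<exists>x0' u' x'. Tr x0' u' x' \<and> g u' = g u \<and> h u' x' = h u x \<and> w = f x' t) = f x' t"
    by (rule someI_ex)
  then show "f x t = (\<lambda>v y t. SOME w. \<exists>x0' u' x'. Tr x0' u' x' \<and> g u' = v \<and> h u' x' = y \<and> w = f x' t)
      (g u) (h u x) t"
    using assms[OF Tr _ _ _ t] by metis
qed

lemma sampling_scheme_nonneg:
  assumes "sampling_scheme ts" "t \<in> set ts"
  shows "0 \<le> t"
  using assms unfolding sampling_scheme_def by (cases ts) force+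

lemma mult_vec_diff_eq_zero_of_outputs_eq:
  fixes C D :: "real mat"
  assumes C: "C \<in> carrier_mat q n" and D: "D \<in> carrier_mat q m"
    and x: "x \<in> carrier_vec n" and x': "x' \<in> carrier_vec n" and u: "u \<in> carrier_vec m"
    and eq: "C *\<^sub>v x + D *\<^sub>v u = C *\<^sub>v x' + D *\<^sub>v u"
  shows "C *\<^sub>v (x - x') = 0\<^sub>v q"
proof (rule eq_vecI)
  fix i assume "i < dim_vec (0\<^sub>v q :: real vec)"
  then have i: "i < q" by simp
  have "(C *\<^sub>v x + D *\<^sub>v u) $ i = (C *\<^sub>v x' + D *\<^sub>v u) $ i" by (simp only: eq)
  then have "(C *\<^sub>v x) $ i = (C *\<^sub>v x') $ i" using i C D by simp
  then show "(C *\<^sub>v (x - x')) $ i = 0\<^sub>v q $ i"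
    unfolding mult_minus_distrib_mat_vec[OF C x x'] using i C by simp
qed (use C in simp)

lemma mult_zero_vec:
  fixes X :: "'a :: semiring_0 mat"
  assumes "X \<in> carrier_mat m n"
  shows "X *\<^sub>v 0\<^sub>v n = 0\<^sub>v m"
  using assms by (intro eq_vecI) auto

lemma eq_of_mult_vec_diff_eq_zero:
  fixes F :: "real mat"
  assumes F: "F \<in> carrier_mat r n" and x: "x \<in> carrier_vec n" and x': "x' \<in> carrier_vec n"
    and eq: "F *\<^sub>v (x - x') = 0\<^sub>v r"
  shows "F *\<^sub>v x = F *\<^sub>v x'"
proof (rule eq_vecI)
  fix i assume "i < dim_vec (F *\<^sub>v x')"
  then have i: "i < r" using F by simp
  have "(F *\<^sub>v x - F *\<^sub>v x') $ i = 0"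
    unfolding mult_minus_distrib_mat_vec[OF F x x', symmetric] eq using i by simp
  then show "(F *\<^sub>v x) $ i = (F *\<^sub>v x') $ i" using i F by simp
qed (use F in simp)

section \<open>Reconstruction in continuous time\<close>

text \<open>\<open>core\<close> isolates the algebra: it turns the \<alpha> C-outputs of a
  difference of trajectories into outputs of the observable subsystem started at \<open>z\<close>.
  The samples and the rank condition then force z = 0.\<close>

lemma sample_functionally_observable_ctI:
  assumes A: "A \<in> carrier_mat n n" and B: "B \<in> carrier_mat n m"
    and C: "C \<in> carrier_mat q n" and D: "D \<in> carrier_mat q m"
    and F: "F \<in> carrier_mat r n" and \<alpha>: "\<alpha> \<in> carrier_mat r q"
    and ob: "A_ob \<in> carrier_mat l l" "F_ob \<in> carrier_mat r l"
    and core: "\<And>e. e \<in> carrier_vec n \<Longrightarrow> \<exists>z\<in>carrier_vec l.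
      (\<forall>k. (\<alpha> * C * A ^\<^sub>m k) *\<^sub>v e = (F_ob * A_ob ^\<^sub>m k) *\<^sub>v z) \<and>
      (z = 0\<^sub>v l \<longrightarrow> (\<forall>k. (F * A ^\<^sub>m k) *\<^sub>v e = 0\<^sub>v r))"
    and ts: "sampling_scheme ts" and rank: "mat_rank (sample_obs_mat_ct A_ob F_ob ts) = l"
  shows "sample_functionally_observable_ct A B C D F ts"
proof -
  \<comment> \<open>The horizon contains every sampling time, so the inputs entering the samples are
    known; adding 1 keeps it positive when 0 is the only sampling time.\<close>
  define tbar where "tbar = Max (set ts) + 1"
  have ts_nonneg: "0 \<le> s" if "s \<in> set ts" for s
    using sampling_scheme_nonneg[OF ts that] .
  have ts_le: "s \<le> tbar" if "s \<in> set ts" for s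
    using Max_ge[OF finite_set that] unfolding tbar_def by simp
  have "0 < tbar"
  proof -
    have "hd ts \<in> set ts" using ts unfolding sampling_scheme_def by simp
    then have "0 \<le> Max (set ts)"
      using ts_nonneg Max_ge[OF finite_set] order_trans by blast
    then show ?thesis unfolding tbar_def by simp
  qed
  have G: "\<alpha> * C \<in> carrier_mat r n" using \<alpha> C by simp
  have "F *\<^sub>v x t = F *\<^sub>v x' t"
    if tr: "trajectory_ct A B x0 u x" and tr': "trajectory_ct A B x0' u' x'"
      and u_eq: "restrict u {0..tbar} = restrict u' {0..tbar}"
      and out_eq: "map (\<lambda>s. C *\<^sub>v x s + D *\<^sub>v u s) ts = map (\<lambda>s. C *\<^sub>v x' s + D *\<^sub>v u' s) ts"
      and t: "t \<in> {0..tbar}" for x0 u x x0' u' x' t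
  proof -
    have u: "u s = u' s" if "s \<in> {0..tbar}" for s
      using fun_cong[OF u_eq, of s] that by simp
    have uc: "u s \<in> carrier_vec m" and xc: "x s \<in> carrier_vec n" and x'c: "x' s \<in> carrier_vec n"
      if "0 \<le> s" for s
      using tr tr' that A B unfolding trajectory_ct_def by auto
    define e where "e s = x s - x' s" for s
    have ec: "e s \<in> carrier_vec n" if "0 \<le> s" for s
      unfolding e_def using xc[OF that] x'c[OF that] by simp
    have e_int: "((\<lambda>s. (A *\<^sub>v e s) $ i) has_integral (e s $ i - e 0 $ i)) {0..s}"
      if s: "0 \<le> s" "s \<le> tbar" and i: "i < n" for s i
    proof -
      have d: "((\<lambda>s. (A *\<^sub>v x s + B *\<^sub>v u s) $ i - (A *\<^sub>v x' s + B *\<^sub>v u' s) $ i) has_integral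
          (x s $ i - x0 $ i) - (x' s $ i - x0' $ i)) {0..s}" if "0 \<le> s" for s
        using tr tr' A i that unfolding trajectory_ct_def by (intro has_integral_diff) auto
      \<comment> \<open>\<open>trajectory_ct\<close> imposes the initial value only through the
        integral equation. Evaluating at time 0, over a degenerate interval, allows
        \<open>x0\<close> and \<open>x0'\<close> to be replaced by the values of the trajectories at
        0.\<close>
      have "(x 0 $ i - x0 $ i) - (x' 0 $ i - x0' $ i) = 0"
        using has_integral_unique[OF d[OF order_refl]] has_integral_refl(2) by fastforce
      then have eq: "(x s $ i - x0 $ i) - (x' s $ i - x0' $ i) = e s $ i - e 0 $ i"
        unfolding e_def using xc[OF s(1)] x'c[OF s(1)] xc[of 0] x'c[of 0] i by simp
      have "(A *\<^sub>v x y + B *\<^sub>v u y) $ i - (A *\<^sub>v x' y + B *\<^sub>v u' y) $ i = (A *\<^sub>v e y) $ i"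
        if "y \<in> {0..s}" for y
      proof -
        have "A *\<^sub>v e y = A *\<^sub>v x y - A *\<^sub>v x' y"
          unfolding e_def using that by (intro mult_minus_distrib_mat_vec[OF A xc x'c]) auto
        then show ?thesis using that s u[of y] i A B by simp
      qed
      then show ?thesis by (rule has_integral_eq[OF _ d[OF s(1), unfolded eq]])
    qed
    obtain z where z: "z \<in> carrier_vec l"
      and Gz: "\<And>k. (\<alpha> * C * A ^\<^sub>m k) *\<^sub>v e 0 = (F_ob * A_ob ^\<^sub>m k) *\<^sub>v z"
      and z0: "z = 0\<^sub>v l \<Longrightarrow> (F * A ^\<^sub>m k) *\<^sub>v e 0 = 0\<^sub>v r" for k
      using core[OF ec[OF order_refl]] by blast
    have sample: "((F_ob * mat_exp (s \<cdot>\<^sub>m A_ob)) *\<^sub>v z) $ i = 0" if s: "s \<in> set ts" and i: "i < r" for s i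
    proof -
      note s_rng = ts_nonneg[OF s] ts_le[OF s]
      have "C *\<^sub>v x s + D *\<^sub>v u s = C *\<^sub>v x' s + D *\<^sub>v u' s"
        using out_eq s by simp
      then have "C *\<^sub>v e s = 0\<^sub>v q"
        unfolding e_def using s_rng u[of s] xc[of s] x'c[of s] uc[of s]
        by (intro mult_vec_diff_eq_zero_of_outputs_eq[OF C D]) auto
      then have "(\<alpha> * C) *\<^sub>v e s = 0\<^sub>v r"
        unfolding assoc_mult_mat_vec[OF \<alpha> C ec[OF s_rng(1)]] using mult_zero_vec[OF \<alpha>] by simp
      moreover have "(\<lambda>k. s ^ k / fact k * ((\<alpha> * C * A ^\<^sub>m k) *\<^sub>v e 0) $ i) sums (((\<alpha> * C) *\<^sub>v e s) $ i)"
        using s_rng by (intro linear_ode_mult_sums[OF G A _ _ _ i] ec e_int) auto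
      \<comment> \<open>By \<open>Gz\<close> this series has the same terms as the preceding one, so
        uniqueness of the sum identifies the sampled subsystem output with the vanishing \<alpha>
        C-output.\<close>
      moreover have "(\<lambda>k. s ^ k / fact k * ((\<alpha> * C * A ^\<^sub>m k) *\<^sub>v e 0) $ i) sums
          (((F_ob * mat_exp (s \<cdot>\<^sub>m A_ob)) *\<^sub>v z) $ i)"
        unfolding Gz by (rule mat_exp_mult_vec_sums[OF ob(2,1) z i])
      ultimately show ?thesis using i sums_unique2 by fastforce
    qed
    have "sample_obs_mat_ct A_ob F_ob ts *\<^sub>v z = 0\<^sub>v (dim_row (sample_obs_mat_ct A_ob F_ob ts))"
      unfolding sample_obs_mat_ct_def
      by (rule stack_mats_mult_vec_eq_zero) (use ob sample in \<open>auto simp: mat_exp_def\<close>)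
    moreover have "sample_obs_mat_ct A_ob F_ob ts \<in> carrier_mat (dim_row (sample_obs_mat_ct A_ob F_ob ts)) l"
      unfolding sample_obs_mat_ct_def carrier_matD(2)[OF ob(1)] by (rule stack_mats_carrier)
    ultimately have "z = 0\<^sub>v l"
      using rank_eq_dim_col_imp_kernel_trivial rank z by blast
    have "F *\<^sub>v e t = 0\<^sub>v r"
    proof (rule eq_vecI)
      fix i assume "i < dim_vec (0\<^sub>v r :: real vec)"
      then have i: "i < r" by simp
      have "(\<lambda>k. t ^ k / fact k * ((F * A ^\<^sub>m k) *\<^sub>v e 0) $ i) sums ((F *\<^sub>v e t) $ i)"
        using t by (intro linear_ode_mult_sums[OF F A _ _ _ i] ec e_int) auto
      then show "(F *\<^sub>v e t) $ i = 0\<^sub>v r $ i"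
        unfolding z0[OF \<open>z = 0\<^sub>v l\<close>] using i sums_unique2[OF _ sums_zero] by simp
    qed (use F in simp)
    then show ?thesis
      unfolding e_def using t by (intro eq_of_mult_vec_diff_eq_zero[OF F xc x'c]) auto
  qed
  then show ?thesis
    unfolding sample_functionally_observable_ct_def
    by (intro exI[of _ tbar] conjI \<open>0 < tbar\<close> exists_reconstruction)
qed

section \<open>Reconstruction in discrete time\<close>

lemma sample_functionally_observable_dtI:
  assumes A: "A \<in> carrier_mat n n" and B: "B \<in> carrier_mat n m"
    and C: "C \<in> carrier_mat q n" and D: "D \<in> carrier_mat q m"
    and F: "F \<in> carrier_mat r n" and \<alpha>: "\<alpha> \<in> carrier_mat r q"
    and ob: "A_ob \<in> carrier_mat l l" "F_ob \<in> carrier_mat r l"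
    and core: "\<And>e. e \<in> carrier_vec n \<Longrightarrow> \<exists>z\<in>carrier_vec l.
      (\<forall>k. (\<alpha> * C * A ^\<^sub>m k) *\<^sub>v e = (F_ob * A_ob ^\<^sub>m k) *\<^sub>v z) \<and>
      (z = 0\<^sub>v l \<longrightarrow> (\<forall>k. (F * A ^\<^sub>m k) *\<^sub>v e = 0\<^sub>v r))"
    and rank: "mat_rank (sample_obs_mat_dt A_ob F_ob ts) = l"
  shows "sample_functionally_observable_dt \<sigma> A B C D F ts"
proof -
  \<comment> \<open>The sum dominates every sampling time. For negative \<open>\<sigma>\<close> the
    value \<open>nat \<sigma>\<close> is 0, and the final 1 makes the bound strict in the other
    case.\<close>
  define tbar where "tbar = sum_list ts + nat \<sigma> + 1"
  have ts_le: "s \<le> tbar" if "s \<in> set ts" for s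
    using member_le_sum_list[OF that] unfolding tbar_def by simp
  have "\<sigma> < int tbar" unfolding tbar_def by simp
  have G: "\<alpha> * C \<in> carrier_mat r n" using \<alpha> C by simp
  have "F *\<^sub>v x t = F *\<^sub>v x' t"
    if tr: "trajectory_dt A B x0 u x" and tr': "trajectory_dt A B x0' u' x'"
      and u_eq: "restrict u {0..tbar} = restrict u' {0..tbar}"
      and out_eq: "map (\<lambda>s. C *\<^sub>v x s + D *\<^sub>v u s) ts = map (\<lambda>s. C *\<^sub>v x' s + D *\<^sub>v u' s) ts"
      and t: "t \<in> {0..tbar}" for x0 u x x0' u' x' t
  proof -
    have u: "u s = u' s" if "s \<le> tbar" for s
      using fun_cong[OF u_eq, of s] that by simp
    have uc: "u s \<in> carrier_vec m" "u' s \<in> carrier_vec m" for s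
      using tr tr' B unfolding trajectory_dt_def by auto
    have xc: "x s \<in> carrier_vec n" and x'c: "x' s \<in> carrier_vec n" for s
      using tr tr' A B unfolding trajectory_dt_def by (induction s) (auto intro!: carrier_vecI)
    define e where "e s = x s - x' s" for s
    have ec: "e s \<in> carrier_vec n" for s
      unfolding e_def using xc x'c by simp
    have e_Suc: "e (Suc s) = A *\<^sub>v e s" if "s \<le> tbar" for s
    proof -
      have "e (Suc s) = (A *\<^sub>v x s + B *\<^sub>v u s) - (A *\<^sub>v x' s + B *\<^sub>v u' s)"
        using tr tr' unfolding e_def trajectory_dt_def by simp
      also have "\<dots> = A *\<^sub>v x s - A *\<^sub>v x' s"
        unfolding u[OF that] using A B by (intro eq_vecI) auto
      finally show ?thesis unfolding e_def mult_minus_distrib_mat_vec[OF A xc x'c] .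
    qed
    \<comment> \<open>\<open>X\<close> is kept arbitrary so that the induction can move one factor
      \<open>A\<close> from the state into the output matrix.\<close>
    have e_pow: "X *\<^sub>v e s = (X * A ^\<^sub>m s) *\<^sub>v e 0"
      if "X \<in> carrier_mat r n" "s \<le> tbar" for X s
      using that
    proof (induction s arbitrary: X)
      case 0
      then show ?case using A by simp
    next
      case (Suc s)
      have "X *\<^sub>v e (Suc s) = (X * A) *\<^sub>v e s"
        using Suc.prems e_Suc[of s] assoc_mult_mat_vec[OF Suc.prems(1) A ec] by simp
      also have "\<dots> = (X * A * A ^\<^sub>m s) *\<^sub>v e 0"
        using Suc.prems A by (intro Suc.IH) auto
      also have "X * A * A ^\<^sub>m s = X * A ^\<^sub>m Suc s"
        using assoc_mult_mat[OF Suc.prems(1) A pow_carrier_mat[OF A]] pow_mat_add[OF A, of 1 s] A by simp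
      finally show ?case .
    qed
    obtain z where z: "z \<in> carrier_vec l"
      and Gz: "\<And>k. (\<alpha> * C * A ^\<^sub>m k) *\<^sub>v e 0 = (F_ob * A_ob ^\<^sub>m k) *\<^sub>v z"
      and z0: "z = 0\<^sub>v l \<Longrightarrow> (F * A ^\<^sub>m k) *\<^sub>v e 0 = 0\<^sub>v r" for k
      using core[OF ec] by blast
    have sample: "((F_ob * A_ob ^\<^sub>m s) *\<^sub>v z) $ i = 0" if s: "s \<in> set ts" and i: "i < r" for s i
    proof -
      have "C *\<^sub>v x s + D *\<^sub>v u s = C *\<^sub>v x' s + D *\<^sub>v u' s"
        using out_eq s by simp
      then have "C *\<^sub>v e s = 0\<^sub>v q"
        unfolding e_def u[OF ts_le[OF s], symmetric]
        by (rule mult_vec_diff_eq_zero_of_outputs_eq[OF C D xc x'c uc(1)])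
      then have "(\<alpha> * C) *\<^sub>v e s = 0\<^sub>v r"
        unfolding assoc_mult_mat_vec[OF \<alpha> C ec] using mult_zero_vec[OF \<alpha>] by simp
      then show ?thesis unfolding e_pow[OF G ts_le[OF s]] Gz using i by simp
    qed
    have "sample_obs_mat_dt A_ob F_ob ts *\<^sub>v z = 0\<^sub>v (dim_row (sample_obs_mat_dt A_ob F_ob ts))"
      unfolding sample_obs_mat_dt_def
      by (rule stack_mats_mult_vec_eq_zero) (use ob sample in auto)
    moreover have "sample_obs_mat_dt A_ob F_ob ts \<in> carrier_mat (dim_row (sample_obs_mat_dt A_ob F_ob ts)) l"
      unfolding sample_obs_mat_dt_def carrier_matD(2)[OF ob(1)] by (rule stack_mats_carrier)
    ultimately have "z = 0\<^sub>v l"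
      using rank_eq_dim_col_imp_kernel_trivial rank z by blast
    then have "F *\<^sub>v e t = 0\<^sub>v r"
      using e_pow[OF F, of t] z0 t by simp
    then show ?thesis
      unfolding e_def by (rule eq_of_mult_vec_diff_eq_zero[OF F xc x'c])
  qed
  then show ?thesis
    unfolding sample_functionally_observable_dt_def
    by (intro exI[of _ tbar] conjI \<open>\<sigma> < int tbar\<close> exists_reconstruction)
qed

section \<open>Combining interpolation, decomposition and reconstruction\<close>

theorem theorem4:
  fixes A B C D F :: "real mat" and n m q r :: nat
    and js :: "(nat \<times> complex) list" and P_J P_J' A_J C_J F_J Q :: "complex mat"
    and \<alpha> :: "real mat" and c :: "nat \<Rightarrow> nat \<Rightarrow> complex"
    and P_oF P_oF' A_ob A21 A_unob F_ob :: "real mat"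
  assumes A: "A \<in> carrier_mat n n" and B: "B \<in> carrier_mat n m"
    and C: "C \<in> carrier_mat q n" and D: "D \<in> carrier_mat q m"
    and F: "F \<in> carrier_mat r n"
    and block_sizes: "\<forall>(k, ev) \<in> set js. k \<ge> 1"
    and A_J: "A_J = jordan_matrix js"
      "similar_mat_wit (map_mat complex_of_real A) A_J P_J P_J'"
    and C_J: "C_J = map_mat complex_of_real C * P_J"
    and F_J: "F_J = map_mat complex_of_real F * P_J"
    and one_block_per_eigenvalue: "distinct (map snd js)"
    and \<alpha>: "\<alpha> \<in> carrier_mat r q"
    and Q: "Q = block_shift_poly js c" "invertible_mat Q"
    and F_J_eq: "F_J = map_mat complex_of_real \<alpha> * C_J * Q"
    and decomp: "observable_decomposition A F P_oF P_oF' A_ob A21 A_unob F_ob"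
  shows "(\<forall>ts :: real list. sampling_scheme ts \<longrightarrow>
            mat_rank (sample_obs_mat_ct A_ob F_ob ts) = n - unobs_dim A F \<longrightarrow>
            sample_functionally_observable_ct A B C D F ts) \<and>
         (\<forall>ts :: nat list. sampling_scheme ts \<longrightarrow>
            mat_rank (sample_obs_mat_dt A_ob F_ob ts) = n - unobs_dim A F \<longrightarrow>
            sample_functionally_observable_dt (int (obs_index A_ob F_ob) - 2) A B C D F ts)"
proof -
  let ?c = "map_mat complex_of_real"
  define l where "l = n - unobs_dim A F"
  have cA: "?c A \<in> carrier_mat n n" and cC: "?c C \<in> carrier_mat q n" and cF: "?c F \<in> carrier_mat r n"
    and c\<alpha>: "?c \<alpha> \<in> carrier_mat r q"
    using A C F \<alpha> by auto
  note P = similar_mat_witD2[OF cA A_J(2)]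
  have n: "n = sum_list (map fst js)"
    using P(5) unfolding A_J(1) by (metis carrier_matD(1) jordan_matrix_dim(1))
  have Qc: "Q \<in> carrier_mat n n"
    unfolding n Q(1) by (rule block_shift_poly_carrier)
  obtain Q' where Q': "Q * Q' = 1\<^sub>m n" "Q' * Q = 1\<^sub>m (dim_row Q')"
    using Q(2) Qc unfolding invertible_mat_def inverts_mat_def by auto
  \<comment> \<open>Invertibility supplies no dimensions for \<open>Q'\<close>; they are read off by
    comparing column numbers in the two inverse equations.\<close>
  have Q'c: "Q' \<in> carrier_mat n n"
    using arg_cong[OF Q'(1), of dim_col] arg_cong[OF Q'(2), of dim_col] Qc by auto
  define S where "S = P_J * Q * P_J'"
  define T where "T = P_J * Q' * P_J'"
  have S: "S \<in> carrier_mat n n" and T: "T \<in> carrier_mat n n"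
    unfolding S_def T_def using P(6,7) Qc Q'c by auto
  have "S * T = P_J * Q * (P_J' * P_J) * Q' * P_J'"
    unfolding S_def T_def using P(6,7) Qc Q'c by (simp add: assoc_mult_mat[of _ n n _ n _ n])
  also have "\<dots> = P_J * (Q * Q') * P_J'"
    unfolding P(2) using P(6,7) Qc Q'c by (simp add: assoc_mult_mat[of _ n n _ n _ n])
  also have "\<dots> = 1\<^sub>m n" unfolding Q'(1) using P by simp
  finally have ST: "S * T = 1\<^sub>m n" .
  have G: "\<alpha> * C \<in> carrier_mat r n" using \<alpha> C by simp
  have cG: "?c (\<alpha> * C) = ?c \<alpha> * ?c C" by (rule of_real_hom.mat_hom_mult[OF \<alpha> C])
  \<comment> \<open>Multiplying \<open>F_J_eq\<close> from the right by the inverse of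
    \<open>P_J\<close> leaves the Jordan coordinates and gives F = \<alpha> C S.\<close>
  have "?c F = ?c F * P_J * P_J'"
    using P(1,6,7) cF by (simp add: assoc_mult_mat[OF cF P(6,7)])
  also have "\<dots> = ?c \<alpha> * (?c C * P_J) * Q * P_J'"
    using F_J_eq unfolding F_J C_J by simp
  also have "\<dots> = ?c (\<alpha> * C) * S"
    unfolding S_def cG using c\<alpha> cC P(6,7) Qc
    by (simp add: assoc_mult_mat[of _ r q _ n _ n] assoc_mult_mat[of _ q n _ n _ n] assoc_mult_mat[of _ r n _ n _ n])
  finally have FS: "?c F = ?c (\<alpha> * C) * S" .
  obtain p where p: "Q $$ (i, j) = (\<Sum>k\<le>degree p. coeff p k * (A_J ^\<^sub>m k) $$ (i, j))"
    if "i < n" "j < n" for i j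
    using block_shift_poly_eq_poly_jordan_matrix[OF one_block_per_eigenvalue, of c]
    unfolding A_J(1) Q(1) n by blast
  \<comment> \<open>Conjugation by \<open>P_J\<close> sends powers of \<open>A_J\<close> to powers
    of A, so the polynomial that gives \<open>Q\<close> from \<open>A_J\<close> gives
    \<open>S\<close> from A.\<close>
  have S_poly: "S $$ (i, j) = (\<Sum>k\<le>degree p. coeff p k * (?c A ^\<^sub>m k) $$ (i, j))"
    if "i < n" "j < n" for i j
    unfolding S_def similar_mat_wit_pow_id[OF A_J(2)]
    by (rule mult_lincomb_index[OF P(6,7) Qc pow_carrier_mat[OF P(5)] p that])
  have core: "\<exists>z\<in>carrier_vec l. (\<forall>k. (\<alpha> * C * A ^\<^sub>m k) *\<^sub>v e = (F_ob * A_ob ^\<^sub>m k) *\<^sub>v z) \<and>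
      (z = 0\<^sub>v l \<longrightarrow> (\<forall>k. (F * A ^\<^sub>m k) *\<^sub>v e = 0\<^sub>v r))" if "e \<in> carrier_vec n" for e
    unfolding l_def
    by (rule observable_part_of_transformed_state[OF A F G S T ST FS S_poly decomp that])
  have ob: "A_ob \<in> carrier_mat l l" "F_ob \<in> carrier_mat r l"
    using decomp A F unfolding observable_decomposition_def Let_def l_def by auto
  show ?thesis
    unfolding l_def[symmetric]
    using sample_functionally_observable_ctI[OF A B C D F \<alpha> ob core]
      sample_functionally_observable_dtI[OF A B C D F \<alpha> ob core] by blast
qed

end
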